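(* Let $I$ be a partition of $n$. Define $\mathbf{g}_I(J):=\chi^J(I)$ for compositions $J$ of $n$: the character of $\mathfrak{S}_n$ associated to the ribbon shape of $J$, evaluated at a permutation with cycle type $I$. Then $\mathbf{g}_I$ is a left eigenfunction of the $a$th Hopf-power Markov chain on compositions of $n$, with eigenvalue $a^{l(I)-n}$.
   Context: A composition of $n$ is a list $I=(i_1,\dots,i_{l(I)})$ of positive integers with sum $|I|=n$; it is a partition if its parts are non-increasing; $l(I)$ is the number of parts; $J\ge I$ means $J$ refines $I$. The ribbon shape of $J=(j_1,\dots,j_{l})$ is the skew shape with $j_1$ boxes in the bottommost row, $j_2$ boxes in the second-to-bottom row, etc., such that the rightmost box of each row is directly below the leftmost box of the row above. $\chi^J$ is the character of the skew representation of $\mathfrak{S}_n$ of that shape (so $\chi^J(\sigma)=\langle p_{\lambda(\sigma)},s_J\rangle$, with $s_J$ the skew Schur function of the ribbon shape, $p_{\lambda(\sigma)}$ the power sum indexed by the cycle type of $\sigma$, and $\langle\,,\rangle$ the Hall inner product). $QSym$ is the subalgebra of the power series over $\mathbb{R}$ in commuting variables $x_1,x_2,\dots$ spanned by $M_I=\sum_{k_1<\dots<k_{l(I)}}x_{k_1}^{i_1}\cdots x_{k_{l(I)}}^{i_{l(I)}}$, with coproduct $\Delta(M_I)=\sum_{j=0}^{l(I)}M_{(i_1,\dots,i_j)}\otimes M_{(i_{j+1},\dots,i_{l(I)})}$, and $F_I=\sum_{J\ge I}M_J$. With $\Psi^a=m^{[a]}\Delta^{[a]}$ ($a$-fold coproduct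 followed by $a$-fold product), the $a$th Hopf-power Markov chain on compositions of $n$ has transition matrix $K$ given by $a^{-n}\Psi^a(F_I)=\sum_{|J|=n}K(I,J)F_J$. A left eigenfunction of eigenvalue $\beta$ is a function $\mathbf g$ with $\sum_{J}\mathbf g(J)K(J,J')=\beta\,\mathbf g(J')$ for all $J'$. *)

theory Defs
  imports Complex_Main "HOL-Library.Poly_Mapping" "HOL-Library.FuncSet"
    "HOL-Library.Multiset" "HOL-Combinatorics.Permutations" "HOL-Combinatorics.Orbits"
begin

section \<open>Formal power series in countably many commuting variables\<close>

text \<open>
  A monomial is its finitely supported exponent vector; the variables are indexed from 0.
\<close>

type_synonym monomial = "nat \<Rightarrow>\<^sub>0 nat"

typedef mpser = "UNIV :: (monomial \<Rightarrow> real) set"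
  morphisms coeff MPS ..

setup_lifting type_definition_mpser

lemma mpser_eqI: "(\<And>m. coeff f m = coeff g m) \<Longrightarrow> f = g"
  by transfer auto

lemma finite_monomial_splits: "finite {(u, v). u + v = (m :: monomial)}"
proof -
  have "finite (PiE (Poly_Mapping.keys m) (\<lambda>i. {..Poly_Mapping.lookup m i}))"
    by (intro finite_PiE) auto
  moreover have "inj_on (\<lambda>(u, v). restrict (Poly_Mapping.lookup u) (Poly_Mapping.keys m))
      {(u, v). u + v = m}"
  proof (rule inj_onI, clarsimp)
    fix u v u' v'
    assume m: "u' + v' = u + v" "m = u + v"
      and eq: "restrict (Poly_Mapping.lookup u) (Poly_Mapping.keys (u + v)) =
               restrict (Poly_Mapping.lookup u') (Poly_Mapping.keys (u + v))"
    have "u = u'"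
    proof (rule poly_mapping_eqI)
      fix k
      show "Poly_Mapping.lookup u k = Poly_Mapping.lookup u' k"
      proof (cases "k \<in> Poly_Mapping.keys (u + v)")
        case True
        then show ?thesis using fun_cong[OF eq, of k] by simp
      next
        case False
        then have "Poly_Mapping.lookup (u + v) k = 0" "Poly_Mapping.lookup (u' + v') k = 0"
          using m by (simp_all add: in_keys_iff)
        then show ?thesis by (simp add: lookup_add)
      qed
    qed
    then show "u = u' \<and> v = v'" using m by simp
  qed
  moreover have "(\<lambda>(u, v). restrict (Poly_Mapping.lookup u) (Poly_Mapping.keys m)) ` {(u, v). u + v = m}
      \<subseteq> PiE (Poly_Mapping.keys m) (\<lambda>i. {..Poly_Mapping.lookup m i})"
    by (auto simp: lookup_add)
  ultimately show ?thesis
    by (meson finite_imageD finite_subset)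
qed

instantiation mpser :: real_vector
begin

lift_definition zero_mpser :: mpser is "\<lambda>_. 0" .
lift_definition plus_mpser :: "mpser \<Rightarrow> mpser \<Rightarrow> mpser" is "\<lambda>f g m. f m + g m" .
lift_definition minus_mpser :: "mpser \<Rightarrow> mpser \<Rightarrow> mpser" is "\<lambda>f g m. f m - g m" .
lift_definition uminus_mpser :: "mpser \<Rightarrow> mpser" is "\<lambda>f m. - f m" .
lift_definition scaleR_mpser :: "real \<Rightarrow> mpser \<Rightarrow> mpser" is "\<lambda>c f m. c * f m" .

instance by standard (transfer; simp add: fun_eq_iff algebra_simps)+

end

instantiation mpser :: comm_ring_1
begin

lift_definition one_mpser :: mpser is "\<lambda>m. if m = 0 then 1 else 0" .
lift_definition times_mpser :: "mpser \<Rightarrow> mpser \<Rightarrow> mpser"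
  is "\<lambda>f g m. \<Sum>(u, v) | u + v = m. f u * g v" .

instance
proof
  fix f g h :: mpser
  show "f * g * h = f * (g * h)"
  proof (transfer, rule ext)
    fix f g h :: "monomial \<Rightarrow> real" and m :: monomial
    have "(\<Sum>(w, r) | w + r = m. (\<Sum>(u, v) | u + v = w. f u * g v) * h r) =
      (\<Sum>(x, y)\<in>Sigma {(w, r). w + r = m} (\<lambda>(w, r). {(u, v). u + v = w}).
         f (fst y) * g (snd y) * h (snd x))"
      by (subst sum.Sigma[symmetric])
        (auto simp: finite_monomial_splits sum_distrib_right split_beta)
    also have "\<dots> =
      (\<Sum>(x, y)\<in>Sigma {(u, w). u + w = m} (\<lambda>(u, w). {(v, r). v + r = w}).
         f (fst x) * (g (fst y) * h (snd y)))"
      by (rule sum.reindex_bij_witness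
          [where i = "\<lambda>((u, w), (v, r)). ((u + v, r), (u, v))"
             and j = "\<lambda>((w, r), (u, v)). ((u, v + r), (v, r))"])
        (auto simp: add.assoc)
    also have "\<dots> = (\<Sum>(u, w) | u + w = m. f u * (\<Sum>(v, r) | v + r = w. g v * h r))"
      by (subst sum.Sigma[symmetric])
        (auto simp: finite_monomial_splits sum_distrib_left split_beta)
    finally show "(\<Sum>(w, r) | w + r = m. (\<Sum>(u, v) | u + v = w. f u * g v) * h r) =
      (\<Sum>(u, w) | u + w = m. f u * (\<Sum>(v, r) | v + r = w. g v * h r))" .
  qed
  show "f * g = g * f"
    by (transfer, rule ext,
        rule sum.reindex_bij_witness[where i = "\<lambda>(u, v). (v, u)" and j = "\<lambda>(u, v). (v, u)"])
      (auto simp: add.commute mult.commute)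
  show "1 * f = f"
  proof (transfer, rule ext)
    fix f :: "monomial \<Rightarrow> real" and m :: monomial
    have "(\<Sum>(u, v) | u + v = m. (if u = 0 then 1 else 0) * f v) =
          (\<Sum>(u, v)\<in>{(0 :: monomial, m)}. (if u = 0 then 1 else 0) * f v)"
      by (rule sum.mono_neutral_right) (auto simp: finite_monomial_splits split: if_splits)
    then show "(\<Sum>(u, v) | u + v = m. (if u = 0 then 1 else 0) * f v) = f m"
      by simp
  qed
  show "(f + g) * h = f * h + g * h"
    by transfer (simp add: fun_eq_iff split_beta sum.distrib ring_distribs)
  show "(0 :: mpser) \<noteq> 1"
    by transfer (metis one_neq_zero)
qed

end

instance mpser :: real_algebra_1
proof
  fix f g :: mpser and c :: real
  show "c *\<^sub>R f * g = c *\<^sub>R (f * g)"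
    by transfer (simp add: fun_eq_iff split_beta sum_distrib_left mult.assoc)
  show "f * c *\<^sub>R g = c *\<^sub>R (f * g)"
    by transfer (simp add: fun_eq_iff split_beta sum_distrib_left mult.left_commute)
qed

text \<open>
  The formal sum of the monomials \<open>\<mu> s\<close> over \<open>s \<in> S\<close>, counted with multiplicity. It is meaningful
  when each monomial occurs finitely often, which is the case in all uses below.
\<close>

definition formal_sum :: "'s set \<Rightarrow> ('s \<Rightarrow> monomial) \<Rightarrow> mpser" where
  "formal_sum S \<mu> = MPS (\<lambda>m. real (card {s \<in> S. \<mu> s = m}))"

text \<open>
  For a basis \<open>(b i)\<close>, \<open>i \<in> S\<close>, of its span: the linear map on that span sending \<open>b i\<close> to \<open>\<phi> i\<close>.
\<close>

definition linear_extension ::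
  "'i set \<Rightarrow> ('i \<Rightarrow> 'v) \<Rightarrow> ('i \<Rightarrow> 'w) \<Rightarrow> 'v::real_vector \<Rightarrow> 'w::real_vector" where
  "linear_extension S b \<phi> f =
     (\<Sum>i | i \<in> S \<and> representation (b ` S) f (b i) \<noteq> 0. representation (b ` S) f (b i) *\<^sub>R \<phi> i)"

section \<open>Compositions and partitions\<close>

definition all_compositions :: "nat list set" where
  "all_compositions = {I. \<forall>i\<in>set I. 0 < i}"

definition compositions :: "nat \<Rightarrow> nat list set" where
  "compositions n = {I \<in> all_compositions. sum_list I = n}"

definition all_partitions :: "nat list set" where
  "all_partitions = {I \<in> all_compositions. sorted_wrt (\<ge>) I}"

definition partitions :: "nat \<Rightarrow> nat list set" where
  "partitions n = {I \<in> all_partitions. sum_list I = n}"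

definition refines :: "nat list \<Rightarrow> nat list \<Rightarrow> bool" where
  "refines J I \<longleftrightarrow> (\<exists>blocks. concat blocks = J \<and> map sum_list blocks = I)"

section \<open>Symmetric functions and ribbon characters\<close>

definition power_sum :: "nat list \<Rightarrow> mpser" where
  "power_sum lam = prod_list (map (\<lambda>k. formal_sum UNIV (\<lambda>i. Poly_Mapping.single i k)) lam)"

definition complete_hom :: "nat list \<Rightarrow> mpser" where
  "complete_hom lam = prod_list (map (\<lambda>k.
     formal_sum {m. (\<Sum>i\<in>Poly_Mapping.keys m. Poly_Mapping.lookup m i) = k} (\<lambda>m. m)) lam)"

definition monomial_sym :: "nat list \<Rightarrow> mpser" where
  "monomial_sym lam =
     formal_sum {m. image_mset (Poly_Mapping.lookup m) (mset_set (Poly_Mapping.keys m)) = mset lam}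
       (\<lambda>m. m)"

text \<open>
  The Hall inner product is the bilinear form on symmetric functions for which the monomial and
  the complete homogeneous symmetric functions are dual bases.
\<close>

definition hall_inner :: "mpser \<Rightarrow> mpser \<Rightarrow> real" where
  "hall_inner f g =
     linear_extension all_partitions monomial_sym
       (\<lambda>lam. linear_extension all_partitions complete_hom
         (\<lambda>mu. if lam = mu then 1 else 0) g) f"

text \<open>
  Shapes are finite sets of boxes (row, column), in matrix coordinates: rows are numbered
  downwards and columns to the right.
\<close>

definition semistandard :: "(nat \<times> nat) set \<Rightarrow> (nat \<times> nat \<Rightarrow> nat) \<Rightarrow> bool" where
  "semistandard D T \<longleftrightarrow>
     (\<forall>r c. (r, c) \<in> D \<and> (r, Suc c) \<in> D \<longrightarrow> T (r, c) \<le> T (r, Suc c)) \<and>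
     (\<forall>r c. (r, c) \<in> D \<and> (Suc r, c) \<in> D \<longrightarrow> T (r, c) < T (Suc r, c))"

definition skew_schur :: "(nat \<times> nat) set \<Rightarrow> mpser" where
  "skew_schur D =
     formal_sum {T \<in> extensional D. semistandard D T} (\<lambda>T. \<Sum>b\<in>D. Poly_Mapping.single (T b) 1)"

text \<open>
  The part \<open>J ! k\<close> is the length of the \<open>k\<close>-th row from the bottom. A row starts in the last column
  of the row below it, hence its first column is the sum of \<open>J ! s - 1\<close> over the rows below.
\<close>

definition ribbon_shape :: "nat list \<Rightarrow> (nat \<times> nat) set" where
  "ribbon_shape J =
     {(length J - 1 - k, c) | k c. k < length J \<and>
        (\<Sum>s<k. (J ! s - 1)) \<le> c \<and> c < (\<Sum>s<k. (J ! s - 1)) + J ! k}"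

text \<open>The cycle lengths (fixed points included) of a permutation of \<open>{1..n}\<close>, in weakly decreasing order.\<close>

definition cycle_type :: "nat \<Rightarrow> (nat \<Rightarrow> nat) \<Rightarrow> nat list" where
  "cycle_type n \<sigma> = rev (sorted_list_of_multiset (image_mset card (mset_set (orbit \<sigma> ` {1..n}))))"

definition ribbon_character :: "nat list \<Rightarrow> (nat \<Rightarrow> nat) \<Rightarrow> real" where
  "ribbon_character J \<sigma> =
     hall_inner (power_sum (cycle_type (sum_list J) \<sigma>)) (skew_schur (ribbon_shape J))"

section \<open>Quasisymmetric functions and the Hopf-power map\<close>

definition M_qsym :: "nat list \<Rightarrow> mpser" where
  "M_qsym I = formal_sum {ks. length ks = length I \<and> sorted_wrt (<) ks}
     (\<lambda>ks. \<Sum>j<length I. Poly_Mapping.single (ks ! j) (I ! j))"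

definition F_qsym :: "nat list \<Rightarrow> mpser" where
  "F_qsym I = (\<Sum>J | J \<in> compositions (sum_list I) \<and> refines J I. M_qsym J)"

instantiation poly_mapping :: (type, real_vector) real_vector
begin

lift_definition scaleR_poly_mapping :: "real \<Rightarrow> ('a \<Rightarrow>\<^sub>0 'b) \<Rightarrow> 'a \<Rightarrow>\<^sub>0 'b"
  is "\<lambda>c f k. c *\<^sub>R f k"
  by (rule finite_subset[rotated]) auto

instance
  by standard (transfer; simp add: fun_eq_iff scaleR_add_right scaleR_add_left)+

end

text \<open>
  The algebra \<open>QSym\<close> is the span of the \<open>M_I\<close> over all compositions \<open>I\<close>. Since these form a basis, the tensors \<open>M_{I_1} \<otimes> \<dots> \<otimes> M_{I_a}\<close> form a basis of the
  \<open>a\<close>-th tensor power. The latter is realised as the free vector space on lists of compositions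
  of length \<open>a\<close>, with \<open>[I_1, \<dots>, I_a]\<close> standing for \<open>M_{I_1} \<otimes> \<dots> \<otimes> M_{I_a}\<close>.
\<close>

type_synonym tens = "nat list list \<Rightarrow>\<^sub>0 real"

definition tensor :: "tens \<Rightarrow> tens \<Rightarrow> tens" where
  "tensor s t = (\<Sum>u\<in>Poly_Mapping.keys s. \<Sum>v\<in>Poly_Mapping.keys t.
     Poly_Mapping.single (u @ v) (Poly_Mapping.lookup s u * Poly_Mapping.lookup t v))"

definition qsym_to_tens :: "mpser \<Rightarrow> tens" where
  "qsym_to_tens = linear_extension all_compositions M_qsym (\<lambda>I. Poly_Mapping.single [I] 1)"

definition coproduct :: "mpser \<Rightarrow> tens" where
  "coproduct = linear_extension all_compositions M_qsym
     (\<lambda>I. \<Sum>j\<le>length I. Poly_Mapping.single [take j I, drop j I] 1)"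

text \<open>The map \<open>id \<otimes> \<dots> \<otimes> id \<otimes> \<Delta>\<close>.\<close>

definition coproduct_last :: "tens \<Rightarrow> tens" where
  "coproduct_last t = (\<Sum>u\<in>Poly_Mapping.keys t.
     Poly_Mapping.lookup t u *\<^sub>R
       tensor (Poly_Mapping.single (butlast u) 1) (coproduct (M_qsym (last u))))"

text \<open>
  For \<open>a \<ge> 1\<close>, the \<open>a\<close>-fold coproduct maps into the \<open>a\<close>-th tensor power; it is the identity for
  \<open>a = 1\<close> and \<open>\<Delta>\<close> for \<open>a = 2\<close>.
\<close>

definition iterated_coproduct :: "nat \<Rightarrow> mpser \<Rightarrow> tens" where
  "iterated_coproduct a f = (coproduct_last ^^ (a - 1)) (qsym_to_tens f)"

definition iterated_product :: "tens \<Rightarrow> mpser" where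
  "iterated_product t =
     (\<Sum>u\<in>Poly_Mapping.keys t. Poly_Mapping.lookup t u *\<^sub>R prod_list (map M_qsym u))"

definition hopf_power :: "nat \<Rightarrow> mpser \<Rightarrow> mpser" where
  "hopf_power a f = iterated_product (iterated_coproduct a f)"

text \<open>
  The entry at \<open>(I, J)\<close> is the coefficient of \<open>F_J\<close> in the expansion of \<open>a^{-n} \<Psi>^a(F_I)\<close> in the
  basis of all \<open>F_J\<close> with \<open>|J| = n\<close>.
\<close>

definition hopf_power_matrix :: "nat \<Rightarrow> nat \<Rightarrow> nat list \<Rightarrow> nat list \<Rightarrow> real" where
  "hopf_power_matrix a n I J =
     representation (F_qsym ` compositions n) ((1 / real a ^ n) *\<^sub>R hopf_power a (F_qsym I)) (F_qsym J)"

definition left_eigenfunction ::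
  "'s set \<Rightarrow> ('s \<Rightarrow> 's \<Rightarrow> real) \<Rightarrow> ('s \<Rightarrow> real) \<Rightarrow> real \<Rightarrow> bool" where
  "left_eigenfunction S K g \<beta> \<longleftrightarrow> (\<forall>y\<in>S. (\<Sum>x\<in>S. g x * K x y) = \<beta> * g y)"

end

theory Submission
  imports Defs
begin

text \<open>
  The ribbon Schur functions satisfy \<open>h_J = \<Sum> s_K\<close>, summed over the coarsenings \<open>K\<close> of \<open>J\<close>. Pairing
  with \<open>p_I\<close> gives the coefficient of \<open>M_J\<close> in \<open>p_I\<close>, so that the values of \<open>g_I\<close> are exactly the
  coefficients of \<open>p_I\<close> in the basis \<open>F\<close>. Hence the theorem says that \<open>p_I\<close> is an eigenvector of
  \<open>\<Psi>\<^sup>a\<close> with eigenvalue \<open>a\<^sup>l\<close>, where \<open>l\<close> is the length of \<open>I\<close>; this holds because \<open>p_I\<close> is a product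
  of \<open>l\<close> primitive elements.

  The Hall inner product is only meaningful because the \<open>h_\<lambda>\<close> are linearly independent: by Newton's
  identities they span the \<open>p_\<lambda>\<close>, whose independence is visible from their leading monomials.
\<close>

section \<open>Linearly independent families\<close>

text \<open>With K the transition matrix, the sum over J of g(J) K(J, J') is the F_J' coefficient of
  a^-n times the sum of g(J) Psi^a(F_J). So a left eigenfunction is the coordinate vector, in the F
  basis, of an eigenvector of Psi^a, and division by a^n turns a^l into a^(l-n). The values of g_I
  are the coordinates of p_I because F_K collects the M_J with J refining K: the M_J coefficient of
  the sum of g(K) F_K is the sum of g(K) over the coarsenings K of J, which is the pairing of p_I
  with h_J.

  The Hopf algebra argument is run on coefficients. The coefficient of p_I at M_J depends only on
  the multiset of parts of J, and a cut of J, that is, a term of the coproduct of M_J, splits this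
  multiset; primitivity becomes an addition formula for these coefficients.

  \<open>representation\<close> and \<open>linear_extension\<close> carry meaning only for
  independent families and inside their spans. Hence the attention to independence of M, F, m and h
  and to membership in spans degree by degree.\<close>

lemma independent_familyI:
  fixes b :: "'i \<Rightarrow> 'v::real_vector"
  assumes "\<And>A c. finite A \<Longrightarrow> A \<subseteq> S \<Longrightarrow> (\<Sum>i\<in>A. c i *\<^sub>R b i) = 0 \<Longrightarrow> \<forall>i\<in>A. c i = 0"
  shows "inj_on b S" and "independent (b ` S)"
proof -
  show inj: "inj_on b S"
  proof (rule inj_onI, rule ccontr)
    fix i j assume ij: "i \<in> S" "j \<in> S" "b i = b j" "i \<noteq> j"
    then have "(\<Sum>k\<in>{i, j}. (if k = i then 1 else - 1) *\<^sub>R b k) = 0"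
      by simp
    from assms[OF _ _ this] ij show False by auto
  qed
  show "independent (b ` S)"
    unfolding independent_explicit_module
  proof (intro allI impI)
    fix t u v
    assume t: "finite t" "t \<subseteq> b ` S" "(\<Sum>v\<in>t. u v *\<^sub>R v) = 0" "v \<in> t"
    from t(1,2) obtain A where A: "finite A" "A \<subseteq> S" "t = b ` A"
      by (metis finite_subset_image)
    have "(\<Sum>i\<in>A. u (b i) *\<^sub>R b i) = 0"
      using t(3) inj A by (simp add: sum.reindex inj_on_subset o_def)
    from assms[OF A(1,2) this] t(4) A(3) show "u v = 0" by auto
  qed
qed

text \<open>Exchange argument: an independent family with \<open>card S\<close> members lies in the
  span of \<open>b'\<close>, while a repetition or a dependency in \<open>b'\<close> would leave a
  spanning set with fewer elements. It carries independence from M to F and from p to h.\<close>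

lemma independent_family_of_spanning:
  fixes b b' :: "'i \<Rightarrow> 'v::real_vector"
  assumes fin: "finite S" and inj: "inj_on b S" and ind: "independent (b ` S)"
    and sub: "b ` S \<subseteq> span (b' ` S)"
  shows "inj_on b' S" and "independent (b' ` S)"
proof -
  have card: "card S \<le> card B" if "finite B" "b' ` S \<subseteq> span B" for B
  proof -
    have "b ` S \<subseteq> span B"
      using sub that(2) by (metis span_mono span_span subset_trans)
    then have "card (b ` S) \<le> card B"
      using independent_span_bound[OF that(1) ind] by blast
    then show ?thesis using inj by (simp add: card_image)
  qed
  have "card S \<le> card (b' ` S)"
    using fin by (intro card) (auto intro: span_base)
  then show "inj_on b' S"
    using fin by (meson card_image_le dual_order.antisym eq_card_imp_inj_on)
  show "independent (b' ` S)"
  proof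
    assume "dependent (b' ` S)"
    then obtain x where x: "x \<in> b' ` S" "x \<in> span (b' ` S - {x})"
      unfolding dependent_def by blast
    have "y \<in> span (b' ` S - {x})" if "y \<in> b' ` S" for y
      using x(2) that by (cases "y = x") (auto intro: span_base)
    then have "b' ` S \<subseteq> span (b' ` S - {x})" by blast
    then have "card S \<le> card (b' ` S - {x})"
      using fin by (intro card) auto
    also have "\<dots> < card (b' ` S)"
      using x fin by (intro psubset_card_mono) auto
    also have "\<dots> \<le> card S"
      using fin by (rule card_image_le)
    finally show False by simp
  qed
qed

lemma representation_family:
  fixes b :: "'i \<Rightarrow> 'v::real_vector"
  assumes inj: "inj_on b S" and ind: "independent (b ` S)"
    and A: "finite A" "A \<subseteq> S" and j: "j \<in> S"
  shows "representation (b ` S) (\<Sum>i\<in>A. c i *\<^sub>R b i) (b j) = (if j \<in> A then c j else 0)"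
proof -
  have "representation (b ` S) (\<Sum>i\<in>A. c i *\<^sub>R b i) (b j)
      = (\<Sum>i\<in>A. representation (b ` S) (c i *\<^sub>R b i) (b j))"
    using A by (subst representation_sum[OF ind]) (auto intro: span_scale span_base)
  also have "\<dots> = (\<Sum>i\<in>A. c i * (if i = j then 1 else 0))"
  proof (rule sum.cong[OF refl])
    fix i assume "i \<in> A"
    then have i: "i \<in> S" using A by auto
    then have "b j = b i \<longleftrightarrow> i = j" using inj j by (auto dest: inj_onD)
    then show "representation (b ` S) (c i *\<^sub>R b i) (b j) = c i * (if i = j then 1 else 0)"
      using i by (simp add: representation_scale[OF ind] representation_basis[OF ind] span_base)
  qed
  also have "\<dots> = (if j \<in> A then c j else 0)"
    using A(1) by (simp add: if_distrib[of "(*) _"] cong: if_cong)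
  finally show ?thesis .
qed

lemma linear_extension_sum:
  fixes b :: "'i \<Rightarrow> 'v::real_vector"
  assumes inj: "inj_on b S" and ind: "independent (b ` S)"
    and A: "finite A" "A \<subseteq> S"
  shows "linear_extension S b \<phi> (\<Sum>i\<in>A. c i *\<^sub>R b i) = (\<Sum>i\<in>A. c i *\<^sub>R \<phi> i)"
proof -
  let ?r = "representation (b ` S) (\<Sum>i\<in>A. c i *\<^sub>R b i)"
  have r: "?r (b j) = (if j \<in> A then c j else 0)" if "j \<in> S" for j
    using representation_family[OF assms that] .
  have "{i. i \<in> S \<and> ?r (b i) \<noteq> 0} = {i\<in>A. c i \<noteq> 0}"
    using A(2) r by (auto split: if_splits)
  then have "linear_extension S b \<phi> (\<Sum>i\<in>A. c i *\<^sub>R b i) = (\<Sum>i\<in>{i\<in>A. c i \<noteq> 0}. ?r (b i) *\<^sub>R \<phi> i)"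
    unfolding linear_extension_def by simp
  also have "\<dots> = (\<Sum>i\<in>{i\<in>A. c i \<noteq> 0}. c i *\<^sub>R \<phi> i)"
    using A(2) by (intro sum.cong refl) (auto simp: r subset_iff)
  also have "\<dots> = (\<Sum>i\<in>A. c i *\<^sub>R \<phi> i)"
    using A(1) by (intro sum.mono_neutral_left) auto
  finally show ?thesis .
qed

lemma linear_extension_base:
  fixes b :: "'i \<Rightarrow> 'v::real_vector"
  assumes "inj_on b S" and "independent (b ` S)" and "i \<in> S"
  shows "linear_extension S b \<phi> (b i) = \<phi> i"
  using linear_extension_sum[OF assms(1,2), of "{i}" \<phi> "\<lambda>_. 1"] assms(3) by simp

text \<open>The coefficients are indexed by \<open>S\<close>, not by its image under
  \<open>b\<close>, so the family may repeat vectors, as h does on rearrangements of a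
  composition.\<close>

lemma span_familyE:
  fixes b :: "'i \<Rightarrow> 'v::real_vector"
  assumes "x \<in> span (b ` S)" and "finite S"
  obtains c where "x = (\<Sum>i\<in>S. c i *\<^sub>R b i)"
proof -
  from assms(1) have "\<exists>c. x = (\<Sum>i\<in>S. c i *\<^sub>R b i)"
  proof (induction rule: span_induct_alt)
    case base
    show ?case by (rule exI[of _ "\<lambda>_. 0"]) simp
  next
    case (step r y z)
    then obtain i c where "i \<in> S" "y = b i" "z = (\<Sum>i\<in>S. c i *\<^sub>R b i)" by auto
    then have "r *\<^sub>R y + z = (\<Sum>j\<in>S. ((if j = i then r else 0) + c j) *\<^sub>R b j)"
      using assms(2) by (simp add: scaleR_add_left sum.distrib if_distrib[of "\<lambda>x. x *\<^sub>R _"] cong: if_cong)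
    then show ?case by (rule exI[of _ "\<lambda>j. (if j = i then r else 0) + c j"])
  qed
  with that show thesis by blast
qed

section \<open>Coefficients of formal series\<close>

lemma coeff_MPS [simp]: "coeff (MPS f) = f"
  by (simp add: MPS_inverse)

lemma coeff_zero [simp]: "coeff 0 m = 0"
  by (simp add: zero_mpser.rep_eq)

lemma coeff_one: "coeff 1 m = (if m = 0 then 1 else 0)"
  by (simp add: one_mpser.rep_eq)

lemma coeff_add [simp]: "coeff (f + g) m = coeff f m + coeff g m"
  by (simp add: plus_mpser.rep_eq)

lemma coeff_scaleR [simp]: "coeff (c *\<^sub>R f) m = c * coeff f m"
  by (simp add: scaleR_mpser.rep_eq)

lemma coeff_sum: "coeff (\<Sum>i\<in>A. f i) m = (\<Sum>i\<in>A. coeff (f i) m)"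
  by (induction A rule: infinite_finite_induct) auto

lemma coeff_mult: "coeff (f * g) m = (\<Sum>(u, v) | u + v = m. coeff f u * coeff g v)"
  by (simp add: times_mpser.rep_eq)

lemma coeff_formal_sum: "coeff (formal_sum S \<mu>) m = real (card {s \<in> S. \<mu> s = m})"
  by (simp add: formal_sum_def)

lemma formal_sum_reindex:
  assumes "bij_betw f S T" and "\<And>s. s \<in> S \<Longrightarrow> \<nu> (f s) = \<mu> s"
  shows "formal_sum S \<mu> = formal_sum T \<nu>"
proof (rule mpser_eqI)
  fix m
  have "inj_on f {s \<in> S. \<mu> s = m}"
    using assms(1) by (auto simp: bij_betw_def intro: inj_on_subset)
  moreover have "{t \<in> T. \<nu> t = m} = f ` {s \<in> S. \<mu> s = m}"
    unfolding bij_betw_imp_surj_on[OF assms(1), symmetric] using assms(2) by auto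
  ultimately have "bij_betw f {s \<in> S. \<mu> s = m} {t \<in> T. \<nu> t = m}"
    by (simp add: bij_betw_def)
  then show "coeff (formal_sum S \<mu>) m = coeff (formal_sum T \<nu>) m"
    by (simp add: coeff_formal_sum bij_betw_same_card)
qed

text \<open>The terms with monomial m are grouped by the factorisation m = u + v. Finite fibres
  matter because \<open>card\<close> gives 0 on infinite sets.\<close>

lemma formal_sum_mult:
  assumes "\<And>m. finite {s \<in> S. \<mu> s = m}" and "\<And>m. finite {t \<in> T. \<nu> t = m}"
  shows "formal_sum S \<mu> * formal_sum T \<nu> = formal_sum (S \<times> T) (\<lambda>(s, t). \<mu> s + \<nu> t)"
proof (rule mpser_eqI)
  fix m
  have "{p \<in> S \<times> T. (case p of (s, t) \<Rightarrow> \<mu> s + \<nu> t) = m}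
      = (\<Union>(u, v)\<in>{(u, v). u + v = m}. {s \<in> S. \<mu> s = u} \<times> {t \<in> T. \<nu> t = v})" (is "?L = ?R")
    by auto
  moreover have "card ?R = (\<Sum>(u, v)\<in>{(u, v). u + v = m}. card ({s \<in> S. \<mu> s = u} \<times> {t \<in> T. \<nu> t = v}))"
    unfolding case_prod_unfold
    by (rule card_UN_disjoint) (auto simp: finite_monomial_splits[unfolded case_prod_unfold] assms)
  ultimately show "coeff (formal_sum S \<mu> * formal_sum T \<nu>) m
      = coeff (formal_sum (S \<times> T) (\<lambda>(s, t). \<mu> s + \<nu> t)) m"
    by (simp add: coeff_mult coeff_formal_sum card_cartesian_product case_prod_unfold)
qed

lemma formal_sum_Un:
  assumes "\<And>m. finite {s \<in> S. \<mu> s = m}" and "\<And>m. finite {t \<in> T. \<mu> t = m}" and "S \<inter> T = {}"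
  shows "formal_sum (S \<union> T) \<mu> = formal_sum S \<mu> + formal_sum T \<mu>"
proof (rule mpser_eqI)
  fix m
  have "{s \<in> S \<union> T. \<mu> s = m} = {s \<in> S. \<mu> s = m} \<union> {t \<in> T. \<mu> t = m}" by auto
  then show "coeff (formal_sum (S \<union> T) \<mu>) m = coeff (formal_sum S \<mu> + formal_sum T \<mu>) m"
    using assms by (simp add: coeff_formal_sum card_Un_disjoint disjoint_iff)
qed

section \<open>Compositions\<close>

lemma all_compositions_Cons [simp]: "k # J \<in> all_compositions \<longleftrightarrow> 0 < k \<and> J \<in> all_compositions"
  by (auto simp: all_compositions_def)

lemma all_compositions_Nil [simp]: "[] \<in> all_compositions"
  by (simp add: all_compositions_def)

lemma all_compositions_append [simp]:
  "I @ J \<in> all_compositions \<longleftrightarrow> I \<in> all_compositions \<and> J \<in> all_compositions"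
  by (auto simp: all_compositions_def)

lemma mem_compositions: "J \<in> compositions n \<longleftrightarrow> J \<in> all_compositions \<and> sum_list J = n"
  by (auto simp: compositions_def)

lemma length_le_sum_list: "J \<in> all_compositions \<Longrightarrow> length J \<le> sum_list J"
  by (induction J) auto

lemma finite_compositions_le: "finite {J \<in> all_compositions. sum_list J \<le> n}"
proof (rule finite_subset)
  show "{J \<in> all_compositions. sum_list J \<le> n} \<subseteq> {J. set J \<subseteq> {..n} \<and> length J \<le> n}"
  proof safe
    fix J x assume J: "J \<in> all_compositions" "sum_list J \<le> n"
    then show "length J \<le> n" using length_le_sum_list order.trans by blast
    assume "x \<in> set J"
    then show "x \<le> n" using member_le_sum_list J(2) order.trans by blast
  qed
qed (simp add: finite_lists_length_le)

lemma finite_compositions [simp]: "finite (compositions n)"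
  by (rule finite_subset[OF _ finite_compositions_le[of n]]) (auto simp: compositions_def)

lemma sum_list_0_composition: "J \<in> all_compositions \<Longrightarrow> sum_list J = 0 \<longleftrightarrow> J = []"
  using length_le_sum_list[of J] by (cases J) auto

lemma refines_refl: "refines J J"
  unfolding refines_def by (rule exI[of _ "map (\<lambda>k. [k]) J"]) (simp add: o_def)

lemma refines_Nil: "K \<in> all_compositions \<Longrightarrow> refines [] K \<longleftrightarrow> K = []"
proof
  assume K: "K \<in> all_compositions" and "refines [] K"
  then obtain bs where "\<forall>b\<in>set bs. b = []" "map sum_list bs = K"
    by (auto simp: refines_def)
  then show "K = []" using K by (cases bs) auto
qed (simp add: refines_refl)

text \<open>The block containing j is j alone, or the rest of it has positive sum k and begins a
  coarsening \<open>k # K0\<close> of J. Multiplying a ribbon by h_j produces the same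
  dichotomy.\<close>

lemma refines_Cons:
  assumes "j # J \<in> all_compositions" and "K \<in> all_compositions"
  shows "refines (j # J) K \<longleftrightarrow>
    (\<exists>K0. K = j # K0 \<and> refines J K0) \<or> (\<exists>k K0. 0 < k \<and> K = (j + k) # K0 \<and> refines J (k # K0))"
    (is "?L \<longleftrightarrow> ?R")
proof
  assume ?L
  then obtain bs where bs: "concat bs = j # J" "map sum_list bs = K" by (auto simp: refines_def)
  then obtain b bs' where b: "bs = b # bs'" by (cases bs) auto
  with bs assms(2) obtain c where c: "b = j # c" by (cases b) auto
  show ?R
  proof (cases "c = []")
    case True
    then show ?thesis using bs b c by (auto simp: refines_def)
  next
    case False
    have "concat (c # bs') = J" using bs b c by simp
    then have "refines J (sum_list c # map sum_list bs')"
      unfolding refines_def by (intro exI[of _ "c # bs'"]) simp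
    moreover have "0 < sum_list c"
    proof -
      have "c \<in> all_compositions" using assms(1) bs(1) b c by (auto simp: all_compositions_def)
      then show ?thesis using False sum_list_0_composition by blast
    qed
    ultimately show ?thesis using bs b c by auto
  qed
next
  assume ?R
  then consider K0 where "K = j # K0" "refines J K0"
    | k K0 where "K = (j + k) # K0" "refines J (k # K0)" by blast
  then show ?L
  proof cases
    case 1
    then obtain bs where "concat bs = J" "map sum_list bs = K0" by (auto simp: refines_def)
    then show ?thesis using 1 unfolding refines_def by (intro exI[of _ "[j] # bs"]) simp
  next
    case 2
    then obtain b bs where "concat (b # bs) = J" "map sum_list (b # bs) = k # K0"
      by (auto simp: refines_def)
    then show ?thesis using 2 unfolding refines_def
      by (intro exI[of _ "(j # b) # bs"]) auto
  qed
qed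

text \<open>Merging parts shortens a composition, so proper refinements are strictly longer. Both
  triangular inversions, of M through F and of ribbons through h, recur on this.\<close>

lemma refines_length:
  assumes "refines J K" and "J \<in> all_compositions" and "K \<in> all_compositions"
  shows "length K \<le> length J" and "length K = length J \<Longrightarrow> K = J"
proof -
  have "length K \<le> length J \<and> (length K = length J \<longrightarrow> K = J)"
    using assms
  proof (induction J arbitrary: K)
    case Nil
    then show ?case by (simp add: refines_Nil)
  next
    case (Cons j J)
    from Cons.prems(1) refines_Cons[OF Cons.prems(2,3)]
    consider K0 where "K = j # K0" "refines J K0"
      | k K0 where "0 < k" "K = (j + k) # K0" "refines J (k # K0)" by blast
    then show ?case
    proof cases
      case 1
      then show ?thesis using Cons by auto
    next
      case 2
      then have "length (k # K0) \<le> length J" using Cons by (metis all_compositions_Cons)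
      then show ?thesis using 2 by auto
    qed
  qed
  then show "length K \<le> length J" and "length K = length J \<Longrightarrow> K = J" by auto
qed

section \<open>Exponent sequences and quasisymmetric functions\<close>

text \<open>The invariant behind quasisymmetry: monomials for which these lists agree have equal
  coefficients in a quasisymmetric function.\<close>

definition exponents :: "monomial \<Rightarrow> nat list" where
  "exponents m = map (Poly_Mapping.lookup m) (sorted_list_of_set (Poly_Mapping.keys m))"

text \<open>Entries of \<open>e\<close> may be 0. This allows a divisor of a monomial to be written
  along the full support of that monomial.\<close>

definition spread :: "nat list \<Rightarrow> nat list \<Rightarrow> monomial" where
  "spread ks e = (\<Sum>j<length e. Poly_Mapping.single (ks ! j) (e ! j))"

lemma lookup_spread_nth:
  assumes "distinct ks" and "length ks = length e" and "j < length e"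
  shows "Poly_Mapping.lookup (spread ks e) (ks ! j) = e ! j"
proof -
  have "Poly_Mapping.lookup (spread ks e) (ks ! j) = (\<Sum>i<length e. if i = j then e ! j else 0)"
    unfolding spread_def lookup_sum
    using assms by (intro sum.cong refl) (auto simp: lookup_single when_def nth_eq_iff_index_eq)
  then show ?thesis using assms by simp
qed

lemma lookup_spread_notin:
  assumes "length ks = length e" and "i \<notin> set ks"
  shows "Poly_Mapping.lookup (spread ks e) i = 0"
  unfolding spread_def lookup_sum
  using assms by (intro sum.neutral) (auto simp: lookup_single when_def)

lemma keys_spread_subset: "length ks = length e \<Longrightarrow> Poly_Mapping.keys (spread ks e) \<subseteq> set ks"
  using lookup_spread_notin by (meson in_keys_iff subsetI)

lemma map_lookup_spread:
  assumes "distinct ks" and "length ks = length e"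
  shows "map (Poly_Mapping.lookup (spread ks e)) ks = e"
  using assms by (intro nth_equalityI) (auto simp: lookup_spread_nth)

lemma spread_map_lookup:
  assumes "distinct ks" and "Poly_Mapping.keys m \<subseteq> set ks"
  shows "spread ks (map (Poly_Mapping.lookup m) ks) = m"
proof (rule poly_mapping_eqI)
  fix i
  show "Poly_Mapping.lookup (spread ks (map (Poly_Mapping.lookup m) ks)) i = Poly_Mapping.lookup m i"
  proof (cases "i \<in> set ks")
    case True
    then obtain j where "j < length ks" "i = ks ! j" by (auto simp: in_set_conv_nth)
    then show ?thesis using assms(1) lookup_spread_nth[of ks "map (Poly_Mapping.lookup m) ks" j] by simp
  next
    case False
    then have "i \<notin> Poly_Mapping.keys m" using assms(2) by auto
    with False show ?thesis by (simp add: lookup_spread_notin in_keys_iff)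
  qed
qed

lemma spread_add:
  assumes "length x = length y"
  shows "spread ks x + spread ks y = spread ks (map2 (+) x y)"
  using assms by (simp add: spread_def sum.distrib[symmetric] single_add)

lemma exponents_eq_filter:
  assumes "sorted_wrt (<) ks" and "Poly_Mapping.keys m \<subseteq> set ks"
  shows "exponents m = filter (\<lambda>x. x \<noteq> 0) (map (Poly_Mapping.lookup m) ks)"
proof -
  have "set (filter (\<lambda>i. i \<in> Poly_Mapping.keys m) ks) = Poly_Mapping.keys m"
    using assms(2) by auto
  moreover have "sorted (filter (\<lambda>i. i \<in> Poly_Mapping.keys m) ks)"
    "distinct (filter (\<lambda>i. i \<in> Poly_Mapping.keys m) ks)"
    using assms(1) by (auto simp: strict_sorted_iff intro: sorted_wrt_filter)
  ultimately have "sorted_list_of_set (Poly_Mapping.keys m) = filter (\<lambda>i. i \<in> Poly_Mapping.keys m) ks"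
    by (metis sorted_list_of_set.idem_if_sorted_distinct)
  then show ?thesis by (simp add: exponents_def filter_map o_def in_keys_iff)
qed

lemma exponents_spread:
  assumes "sorted_wrt (<) ks" and "length ks = length e"
  shows "exponents (spread ks e) = filter (\<lambda>x. x \<noteq> 0) e"
  using assms exponents_eq_filter[OF assms(1) keys_spread_subset[OF assms(2)]]
  by (simp add: map_lookup_spread strict_sorted_iff)

lemma exponents_in_all_compositions [simp]: "exponents m \<in> all_compositions"
  by (auto simp: exponents_def all_compositions_def in_keys_iff)

lemma filter_nonzero_composition: "J \<in> all_compositions \<Longrightarrow> filter (\<lambda>x. x \<noteq> 0) J = J"
  by (auto simp: all_compositions_def intro!: filter_True)

lemma exponents_surj:
  assumes "J \<in> all_compositions"
  obtains m where "exponents m = J"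
  using exponents_spread[of "[0..<length J]" J] filter_nonzero_composition[OF assms] by force

lemma mset_exponents:
  "mset (exponents m) = image_mset (Poly_Mapping.lookup m) (mset_set (Poly_Mapping.keys m))"
  unfolding exponents_def
  by (metis mset_map mset_sorted_list_of_multiset sorted_list_of_mset_set)

lemma sum_list_exponents:
  assumes "finite K" and "Poly_Mapping.keys m \<subseteq> K"
  shows "sum_list (exponents m) = (\<Sum>i\<in>K. Poly_Mapping.lookup m i)"
proof -
  have "sum_list (exponents m) = (\<Sum>i\<in>Poly_Mapping.keys m. Poly_Mapping.lookup m i)"
    by (metis mset_exponents sum_mset_sum_list sum_unfold_sum_mset)
  also have "\<dots> = (\<Sum>i\<in>K. Poly_Mapping.lookup m i)"
    using assms by (intro sum.mono_neutral_left) (auto simp: in_keys_iff)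
  finally show ?thesis .
qed

lemma sum_list_exponents_add:
  "sum_list (exponents (u + v)) = sum_list (exponents u) + sum_list (exponents v)"
proof -
  let ?K = "Poly_Mapping.keys u \<union> Poly_Mapping.keys v"
  have "Poly_Mapping.keys (u + v) \<subseteq> ?K" by (rule Poly_Mapping.keys_add)
  then show ?thesis
    by (simp add: sum_list_exponents[of ?K] lookup_add sum.distrib)
qed

lemma exponents_eq_Nil [simp]: "exponents m = [] \<longleftrightarrow> m = 0"
  by (simp add: exponents_def)

text \<open>The parts of J are positive, so the variables in \<open>ks\<close> are exactly the
  support of m, and increasing order leaves a single choice. Distinct M_J therefore have no monomial
  in common.\<close>

lemma coeff_M_qsym:
  assumes "J \<in> all_compositions"
  shows "coeff (M_qsym J) m = (if exponents m = J then 1 else 0)"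
proof -
  let ?ks = "sorted_list_of_set (Poly_Mapping.keys m)"
  let ?S = "{ks \<in> {ks. length ks = length J \<and> sorted_wrt (<) ks}. spread ks J = m}"
  have *: "exponents m = J \<and> ks = ?ks" if "ks \<in> ?S" for ks
  proof -
    from that have ks: "length ks = length J" "sorted_wrt (<) ks" "spread ks J = m" by auto
    then have J: "map (Poly_Mapping.lookup m) ks = J"
      using map_lookup_spread by (auto simp: strict_sorted_iff)
    have "Poly_Mapping.lookup m i \<noteq> 0" if "i \<in> set ks" for i
    proof -
      have "Poly_Mapping.lookup m i \<in> set J" using that J by (metis image_eqI set_map)
      then show ?thesis using assms by (auto simp: all_compositions_def)
    qed
    then have "set ks = Poly_Mapping.keys m"
      using keys_spread_subset[of ks J] ks by (auto simp: in_keys_iff)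
    then have "ks = ?ks"
      using ks(2) by (metis sorted_list_of_set.idem_if_sorted_distinct strict_sorted_iff)
    with J show ?thesis by (simp add: exponents_def)
  qed
  have "?S = (if exponents m = J then {?ks} else {})"
  proof (cases "exponents m = J")
    case True
    then have "?ks \<in> ?S"
      using spread_map_lookup[of ?ks m] by (auto simp: exponents_def)
    with * True show ?thesis by auto
  qed (use * in auto)
  then have "card ?S = (if exponents m = J then 1 else 0)"
    by (simp only: if_distrib[of card] card.empty is_singletonI is_singleton_altdef[symmetric] cong: if_cong) auto
  then show ?thesis
    unfolding M_qsym_def coeff_formal_sum spread_def by simp
qed

lemma quasisymmetric_expansion:
  assumes "\<And>m. coeff f m = c (exponents m)" and "finite A" "A \<subseteq> all_compositions"
    and "\<And>J. J \<in> all_compositions \<Longrightarrow> c J \<noteq> 0 \<Longrightarrow> J \<in> A"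
  shows "f = (\<Sum>J\<in>A. c J *\<^sub>R M_qsym J)"
proof (rule mpser_eqI)
  fix m
  have "coeff (\<Sum>J\<in>A. c J *\<^sub>R M_qsym J) m = (\<Sum>J\<in>A. if J = exponents m then c (exponents m) else 0)"
    unfolding coeff_sum using assms(3) by (intro sum.cong refl) (auto simp: coeff_M_qsym subset_iff)
  also have "\<dots> = c (exponents m)"
    using assms(2) assms(4)[of "exponents m"] by auto
  finally show "coeff f m = coeff (\<Sum>J\<in>A. c J *\<^sub>R M_qsym J) m"
    using assms(1) by simp
qed

lemma span_M_qsym_iff:
  "f \<in> span (M_qsym ` compositions n) \<longleftrightarrow>
     (\<exists>c. (\<forall>m. coeff f m = c (exponents m)) \<and> (\<forall>J. c J \<noteq> 0 \<longrightarrow> sum_list J = n))"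
proof
  assume "f \<in> span (M_qsym ` compositions n)"
  then obtain d where f: "f = (\<Sum>J\<in>compositions n. d J *\<^sub>R M_qsym J)"
    by (rule span_familyE) simp
  have "coeff f m = (if exponents m \<in> compositions n then d (exponents m) else 0)" for m
  proof -
    have "coeff f m = (\<Sum>J\<in>compositions n. if J = exponents m then d (exponents m) else 0)"
      unfolding f coeff_sum by (intro sum.cong refl) (auto simp: coeff_M_qsym mem_compositions)
    then show ?thesis by simp
  qed
  then show "\<exists>c. (\<forall>m. coeff f m = c (exponents m)) \<and> (\<forall>J. c J \<noteq> 0 \<longrightarrow> sum_list J = n)"
    by (intro exI[of _ "\<lambda>J. if J \<in> compositions n then d J else 0"]) (auto simp: mem_compositions)
next
  assume "\<exists>c. (\<forall>m. coeff f m = c (exponents m)) \<and> (\<forall>J. c J \<noteq> 0 \<longrightarrow> sum_list J = n)"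
  then obtain c where c: "\<And>m. coeff f m = c (exponents m)" "\<And>J. c J \<noteq> 0 \<Longrightarrow> sum_list J = n"
    by blast
  have "f = (\<Sum>J\<in>compositions n. c J *\<^sub>R M_qsym J)"
    by (rule quasisymmetric_expansion) (use c in \<open>auto simp: mem_compositions\<close>)
  then show "f \<in> span (M_qsym ` compositions n)"
    by (metis (no_types, lifting) image_eqI span_base span_scale span_sum)
qed

text \<open>A factorisation m = u + v amounts to two lists along the support of m, zeros allowed,
  that add up entrywise; removing zeros recovers the exponent lists of u and v. The right-hand side
  sees m only through \<open>exponents m\<close>, which is why products of quasisymmetric functions
  are quasisymmetric.\<close>

lemma coeff_mult_quasisymmetric:
  assumes "\<And>m. coeff f m = c (exponents m)" and "\<And>m. coeff g m = d (exponents m)"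
  shows "coeff (f * g) m =
    (\<Sum>(x, y) | length x = length (exponents m) \<and> length y = length (exponents m) \<and>
       map2 (+) x y = exponents m. c (filter (\<lambda>k. k \<noteq> 0) x) * d (filter (\<lambda>k. k \<noteq> 0) y))"
proof -
  define ks where "ks = sorted_list_of_set (Poly_Mapping.keys m)"
  have ks: "sorted_wrt (<) ks" "distinct ks" "set ks = Poly_Mapping.keys m"
    "length ks = length (exponents m)" "map (Poly_Mapping.lookup m) ks = exponents m"
    by (simp_all add: ks_def exponents_def)
  have keys: "Poly_Mapping.keys u \<subseteq> set ks" "Poly_Mapping.keys v \<subseteq> set ks" if "u + v = m" for u v
    unfolding ks(3) that[symmetric] by (auto simp: in_keys_iff lookup_add)
  show ?thesis
    unfolding coeff_mult
  proof (rule sum.reindex_bij_witness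
      [where i = "\<lambda>(x, y). (spread ks x, spread ks y)"
         and j = "\<lambda>(u, v). (map (Poly_Mapping.lookup u) ks, map (Poly_Mapping.lookup v) ks)"],
      goal_cases)
    case (1 p)
    then obtain u v where p: "p = (u, v)" "u + v = m" by auto
    then show ?case using keys[OF p(2)] ks(2) by (simp add: spread_map_lookup)
  next
    case (2 p)
    then obtain u v where p: "p = (u, v)" "u + v = m" by auto
    have "map2 (+) (map (Poly_Mapping.lookup u) ks) (map (Poly_Mapping.lookup v) ks)
        = map (Poly_Mapping.lookup (u + v)) ks"
      by (rule nth_equalityI) (auto simp: lookup_add)
    then show ?case using p ks by simp
  next
    case (3 q)
    then show ?case using ks by (auto simp: map_lookup_spread)
  next
    case (4 q)
    then obtain x y where q: "q = (x, y)" "length x = length ks" "length y = length ks"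
      "map2 (+) x y = exponents m" using ks(4) by auto
    have "spread ks x + spread ks y = spread ks (exponents m)"
      using q by (simp add: spread_add)
    also have "\<dots> = m"
      using spread_map_lookup[OF ks(2), of m] ks by simp
    finally show ?case using q by simp
  next
    case (5 p)
    then obtain u v where p: "p = (u, v)" "u + v = m" by auto
    then show ?case using assms keys[OF p(2)] ks(1) by (simp add: exponents_eq_filter)
  qed
qed

lemma M_qsym_span_mult:
  assumes "f \<in> span (M_qsym ` compositions j)" and "g \<in> span (M_qsym ` compositions k)"
  shows "f * g \<in> span (M_qsym ` compositions (j + k))"
proof -
  obtain c where c: "\<And>m. coeff f m = c (exponents m)" "\<And>J. c J \<noteq> 0 \<Longrightarrow> sum_list J = j"
    using assms(1) unfolding span_M_qsym_iff by blast
  obtain d where d: "\<And>m. coeff g m = d (exponents m)" "\<And>J. d J \<noteq> 0 \<Longrightarrow> sum_list J = k"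
    using assms(2) unfolding span_M_qsym_iff by blast
  let ?b = "\<lambda>E. \<Sum>(x, y) | length x = length E \<and> length y = length E \<and>
       map2 (+) x y = E. c (filter (\<lambda>k. k \<noteq> 0) x) * d (filter (\<lambda>k. k \<noteq> 0) y)"
  have 1: "coeff (f * g) m = ?b (exponents m)" for m
    using c(1) d(1) by (rule coeff_mult_quasisymmetric)
  have "sum_list (exponents m) = j + k" if "coeff (f * g) m \<noteq> 0" for m
  proof -
    from that obtain u v where "u + v = m" "coeff f u \<noteq> 0" "coeff g v \<noteq> 0"
      unfolding coeff_mult by (auto elim!: sum.not_neutral_contains_not_neutral)
    then show ?thesis
      using c d sum_list_exponents_add[of u v] by auto
  qed
  \<comment> \<open>The degree argument covers only lists of the form \<open>exponents m\<close>,
    whereas the criterion for the span speaks of all lists; hence the truncation of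
    \<open>?b\<close> to sum j + k.\<close>
  then have "\<forall>m. coeff (f * g) m = (if sum_list (exponents m) = j + k then ?b (exponents m) else 0)"
    using 1 by metis
  then show ?thesis
    unfolding span_M_qsym_iff
    by (intro exI[of _ "\<lambda>E. if sum_list E = j + k then ?b E else 0"]) auto
qed

lemma M_qsym_independent:
  shows "inj_on M_qsym all_compositions" and "independent (M_qsym ` all_compositions)"
proof -
  have *: "\<forall>J\<in>A. c J = 0"
    if A: "finite A" "A \<subseteq> all_compositions" and 0: "(\<Sum>J\<in>A. c J *\<^sub>R M_qsym J) = 0" for A c
  proof
    fix J assume J: "J \<in> A"
    then obtain m where m: "exponents m = J" using A(2) exponents_surj by blast
    have "coeff (\<Sum>J\<in>A. c J *\<^sub>R M_qsym J) m = (\<Sum>K\<in>A. if K = J then c J else 0)"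
      unfolding coeff_sum using A(2) m by (intro sum.cong refl) (auto simp: coeff_M_qsym subset_iff)
    then show "c J = 0" using 0 J A(1) by simp
  qed
  show "inj_on M_qsym all_compositions" "independent (M_qsym ` all_compositions)"
    using independent_familyI[of all_compositions M_qsym] * by blast+
qed

lemma compositions_subset: "compositions n \<subseteq> all_compositions"
  by (auto simp: compositions_def)

section \<open>From the M basis to the F basis\<close>

lemma F_qsym_in_span: "J \<in> compositions n \<Longrightarrow> F_qsym J \<in> span (M_qsym ` compositions n)"
  unfolding F_qsym_def by (rule span_sum, rule span_base) (auto simp: mem_compositions)

text \<open>Triangularity: F_J is M_J plus terms M_K with K properly finer, hence longer. Lengths
  are bounded by n, so \<open>n - length J\<close> decreases.\<close>

lemma M_qsym_in_span_F_qsym: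
  assumes "J \<in> compositions n"
  shows "M_qsym J \<in> span (F_qsym ` compositions n)"
  using assms
proof (induction "n - length J" arbitrary: J rule: less_induct)
  case less
  let ?R = "{K \<in> compositions n. refines K J}"
  have n: "sum_list J = n" "J \<in> all_compositions" using less.prems by (auto simp: mem_compositions)
  have J: "J \<in> ?R" using less.prems by (simp add: refines_refl)
  have "F_qsym J = M_qsym J + (\<Sum>K\<in>?R - {J}. M_qsym K)"
    unfolding F_qsym_def n(1) using J by (intro sum.remove) auto
  then have "M_qsym J = F_qsym J - (\<Sum>K\<in>?R - {J}. M_qsym K)" by simp
  also have "\<dots> \<in> span (F_qsym ` compositions n)"
  proof (intro span_diff span_sum)
    fix K assume K: "K \<in> ?R - {J}"
    then have "K \<in> all_compositions" by (auto simp: mem_compositions)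
    with K n have "length J < length K"
      using refines_length[of K J] by force
    moreover have "length K \<le> n" using K length_le_sum_list[of K] by (auto simp: mem_compositions)
    ultimately show "M_qsym K \<in> span (F_qsym ` compositions n)"
      using K by (intro less.hyps) auto
  qed (use less.prems in \<open>auto intro: span_base\<close>)
  finally show ?case .
qed

lemma F_qsym_independent:
  shows "inj_on F_qsym (compositions n)" and "independent (F_qsym ` compositions n)"
proof -
  have M: "inj_on M_qsym (compositions n)" "independent (M_qsym ` compositions n)"
    using M_qsym_independent compositions_subset
    by (auto intro: inj_on_subset dependent_mono[OF _ image_mono])
  have "M_qsym ` compositions n \<subseteq> span (F_qsym ` compositions n)"
    using M_qsym_in_span_F_qsym by blast
  from independent_family_of_spanning[OF _ M this]
  show "inj_on F_qsym (compositions n)" "independent (F_qsym ` compositions n)" by auto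
qed

lemma span_F_qsym: "span (F_qsym ` compositions n) = span (M_qsym ` compositions n)"
  using M_qsym_in_span_F_qsym F_qsym_in_span by (auto simp: span_eq)

section \<open>Power sums\<close>

text \<open>Multiplication by p_k means choosing the variable of m from which x_i^k is taken; as k
  is positive, it lies in the support of m.\<close>

lemma coeff_power_sum_mult:
  assumes "0 < k"
  shows "coeff (formal_sum UNIV (\<lambda>i. Poly_Mapping.single i k) * f) m =
    (\<Sum>i\<in>Poly_Mapping.keys m. if k \<le> Poly_Mapping.lookup m i
       then coeff f (m - Poly_Mapping.single i k) else 0)"
proof -
  let ?S = "{i \<in> Poly_Mapping.keys m. k \<le> Poly_Mapping.lookup m i}"
  let ?h = "\<lambda>i. (Poly_Mapping.single i k, m - Poly_Mapping.single i k)"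
  have single_eq: "Poly_Mapping.single i k = Poly_Mapping.single j k \<longleftrightarrow> i = j" for i j :: nat
    using assms by (metis lookup_single_eq lookup_single_not_eq neq0_conv)
  have coeff_p: "coeff (formal_sum UNIV (\<lambda>i. Poly_Mapping.single i k)) (Poly_Mapping.single i k) = 1" for i
    by (simp add: coeff_formal_sum single_eq)
  have split: "Poly_Mapping.single i k + (m - Poly_Mapping.single i k) = m"
    if "k \<le> Poly_Mapping.lookup m i" for i
    using that by (intro poly_mapping_eqI) (auto simp: lookup_add lookup_minus lookup_single when_def)
  have "coeff (formal_sum UNIV (\<lambda>i. Poly_Mapping.single i k) * f) m
      = (\<Sum>(u, v)\<in>?h ` ?S. coeff (formal_sum UNIV (\<lambda>i. Poly_Mapping.single i k)) u * coeff f v)"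
    unfolding coeff_mult
  proof (rule sum.mono_neutral_right)
    show "?h ` ?S \<subseteq> {(u, v). u + v = m}" using split by auto
    show "\<forall>p\<in>{(u, v). u + v = m} - ?h ` ?S. (case p of (u, v) \<Rightarrow>
        coeff (formal_sum UNIV (\<lambda>i. Poly_Mapping.single i k)) u * coeff f v) = 0"
    proof clarsimp
      fix u v assume m: "m = u + v"
        and *: "(u, v) \<notin> (\<lambda>i. (Poly_Mapping.single i k, u + v - Poly_Mapping.single i k)) `
          {i \<in> Poly_Mapping.keys (u + v). k \<le> Poly_Mapping.lookup (u + v) i}"
          and "coeff f v \<noteq> 0"
      have "u \<noteq> Poly_Mapping.single i k" for i
      proof
        assume u: "u = Poly_Mapping.single i k"
        have "i \<in> Poly_Mapping.keys (u + v)" "k \<le> Poly_Mapping.lookup (u + v) i"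
          using assms by (auto simp: u in_keys_iff lookup_add)
        then show False using * u by auto
      qed
      then have "{i. Poly_Mapping.single i k = u} = {}" by auto
      then show "coeff (formal_sum UNIV (\<lambda>i. Poly_Mapping.single i k)) u = 0"
        by (simp add: coeff_formal_sum)
    qed
  qed (rule finite_monomial_splits)
  also have "\<dots> = (\<Sum>i\<in>?S. coeff f (m - Poly_Mapping.single i k))"
    by (subst sum.reindex) (auto simp: inj_on_def single_eq coeff_p)
  also have "\<dots> = (\<Sum>i\<in>Poly_Mapping.keys m. if k \<le> Poly_Mapping.lookup m i
       then coeff f (m - Poly_Mapping.single i k) else 0)"
    by (rule sum.inter_filter) simp
  finally show ?thesis .
qed

text \<open>Effect on the multiset of exponents of dividing by x_i^k when x_i has exponent e. An
  exponent that reaches 0 disappears, since only positive ones are recorded.\<close>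

definition lower :: "nat \<Rightarrow> nat \<Rightarrow> nat multiset \<Rightarrow> nat multiset" where
  "lower k e E = (E - {#e#}) + (if e = k then {#} else {#e - k#})"

lemma mset_exponents_minus_single:
  assumes "0 < k" and "k \<le> Poly_Mapping.lookup m i"
  shows "mset (exponents (m - Poly_Mapping.single i k)) =
    lower k (Poly_Mapping.lookup m i) (mset (exponents m))"
proof -
  let ?m = "m - Poly_Mapping.single i k" and ?K = "Poly_Mapping.keys m - {i}"
  have i: "i \<in> Poly_Mapping.keys m" using assms by (auto simp: in_keys_iff)
  have look: "Poly_Mapping.lookup ?m j = (if j = i then Poly_Mapping.lookup m i - k else Poly_Mapping.lookup m j)" for j
    by (auto simp: lookup_minus lookup_single when_def)
  have keys: "Poly_Mapping.keys ?m = {j. (if j = i then Poly_Mapping.lookup m i - k else Poly_Mapping.lookup m j) \<noteq> 0}"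
    unfolding look[symmetric] by (auto simp: in_keys_iff)
  have K: "image_mset (Poly_Mapping.lookup ?m) (mset_set ?K) = image_mset (Poly_Mapping.lookup m) (mset_set ?K)"
    by (rule image_mset_cong) (auto simp: look)
  have "mset_set (Poly_Mapping.keys m) = add_mset i (mset_set ?K)"
    using i by (simp add: mset_set.remove)
  then have m: "mset (exponents m) = add_mset (Poly_Mapping.lookup m i) (image_mset (Poly_Mapping.lookup m) (mset_set ?K))"
    by (simp add: mset_exponents)
  show ?thesis
  proof (cases "Poly_Mapping.lookup m i = k")
    case True
    then have "Poly_Mapping.keys ?m = ?K" unfolding keys by (auto simp: in_keys_iff)
    then show ?thesis using K True by (simp add: m mset_exponents[of ?m] lower_def)
  next
    case False
    then have "Poly_Mapping.keys ?m = Poly_Mapping.keys m"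
      unfolding keys using assms i by (auto simp: in_keys_iff)
    then have "mset_set (Poly_Mapping.keys ?m) = add_mset i (mset_set ?K)"
      using i by (simp add: mset_set.remove)
    then show ?thesis using K False by (simp add: m mset_exponents[of ?m] lower_def look)
  qed
qed

text \<open>The coefficient of p_I at any monomial whose multiset of exponents is \<open>E\<close>:
  each part in turn picks the variable it is taken from. Equal exponents of different variables are
  different choices, which summation over a multiset respects.\<close>

primrec power_sum_coeff :: "nat list \<Rightarrow> nat multiset \<Rightarrow> real" where
  "power_sum_coeff [] E = (if E = {#} then 1 else 0)"
| "power_sum_coeff (k # I) E = (\<Sum>e\<in>#E. if k \<le> e then power_sum_coeff I (lower k e E) else 0)"

lemma power_sum_Nil [simp]: "power_sum [] = 1"
  by (simp add: power_sum_def)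

lemma power_sum_Cons:
  "power_sum (k # I) = formal_sum UNIV (\<lambda>i. Poly_Mapping.single i k) * power_sum I"
  by (simp add: power_sum_def)

lemma coeff_power_sum:
  "I \<in> all_compositions \<Longrightarrow> coeff (power_sum I) m = power_sum_coeff I (mset (exponents m))"
proof (induction I arbitrary: m)
  case Nil
  show ?case by (simp add: coeff_one)
next
  case (Cons k I)
  then have k: "0 < k" and I: "I \<in> all_compositions" by auto
  have "coeff (power_sum (k # I)) m = (\<Sum>i\<in>Poly_Mapping.keys m. if k \<le> Poly_Mapping.lookup m i
       then power_sum_coeff I (lower k (Poly_Mapping.lookup m i) (mset (exponents m))) else 0)"
    unfolding power_sum_Cons coeff_power_sum_mult[OF k]
    using Cons.IH[OF I] mset_exponents_minus_single[OF k] by (intro sum.cong refl) simp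
  also have "\<dots> = power_sum_coeff (k # I) (mset (exponents m))"
    unfolding power_sum_coeff.simps mset_exponents[of m]
    by (simp add: sum_unfold_sum_mset o_def image_mset.compositionality)
  finally show ?case .
qed

lemma power_sum_coeff_neq_0_Cons:
  assumes "power_sum_coeff (k # I) E \<noteq> 0"
  obtains e E' where "E = add_mset e E'" "k \<le> e" "power_sum_coeff I (lower k e E) \<noteq> 0"
proof -
  have "\<exists>e\<in>#E. (if k \<le> e then power_sum_coeff I (lower k e E) else 0) \<noteq> 0"
    using assms sum_mset.neutral[of "image_mset (\<lambda>e. if k \<le> e then power_sum_coeff I (lower k e E) else 0) E"]
    by fastforce
  then obtain e where "e \<in># E" "k \<le> e" "power_sum_coeff I (lower k e E) \<noteq> 0" by (auto split: if_splits)
  with that show thesis by (metis multi_member_split)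
qed

lemma power_sum_coeff_degree: "power_sum_coeff I E \<noteq> 0 \<Longrightarrow> sum_mset E = sum_list I"
proof (induction I arbitrary: E)
  case Nil
  then show ?case by (auto split: if_splits)
next
  case (Cons k I)
  from Cons.prems obtain e E' where e: "E = add_mset e E'" "k \<le> e" "power_sum_coeff I (lower k e E) \<noteq> 0"
    by (rule power_sum_coeff_neq_0_Cons)
  from Cons.IH[OF e(3)] e(1,2) show ?case by (auto simp: lower_def split: if_splits)
qed

text \<open>A part removes at most one exponent, and all exponents must be used up by at most as
  many parts. So every part consumes a whole exponent. This makes the p triangular with respect to
  length.\<close>

lemma power_sum_coeff_size:
  assumes "power_sum_coeff I E \<noteq> 0" and "length I \<le> size E"
  shows "E = mset I"
  using assms
proof (induction I arbitrary: E)
  case Nil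
  then show ?case by (auto split: if_splits)
next
  case (Cons k I)
  from Cons.prems(1) obtain e E' where e: "E = add_mset e E'" "k \<le> e" "power_sum_coeff I (lower k e E) \<noteq> 0"
    by (rule power_sum_coeff_neq_0_Cons)
  have "length I \<le> size (lower k e E)"
    using e(1) Cons.prems(2) by (auto simp: lower_def)
  from Cons.IH[OF e(3) this] have low: "lower k e E = mset I" .
  have "e = k"
  proof (rule ccontr)
    assume "e \<noteq> k"
    then have "size (lower k e E) = size E" using e(1) by (simp add: lower_def)
    then show False using low Cons.prems(2) by simp
  qed
  then show ?case using low e(1) by (simp add: lower_def)
qed

lemma sum_mset_nonneg_real:
  fixes f :: "'a \<Rightarrow> real"
  shows "(\<And>x. 0 \<le> f x) \<Longrightarrow> 0 \<le> (\<Sum>x\<in>#E. f x)"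
  by (induction E) auto

lemma power_sum_coeff_nonneg: "0 \<le> power_sum_coeff I E"
  by (induction I arbitrary: E) (auto intro!: sum_mset_nonneg_real)

text \<open>Letting each part consume the exponent equal to it gives one positive term, and no term
  is negative.\<close>

lemma power_sum_coeff_mset_pos: "0 < power_sum_coeff I (mset I)"
proof (induction I)
  case (Cons k I)
  let ?f = "\<lambda>e. if k \<le> e then power_sum_coeff I (lower k e (mset (k # I))) else 0"
  have "?f k = power_sum_coeff I (mset I)" by (simp add: lower_def)
  moreover have "0 \<le> (\<Sum>e\<in>#mset I. ?f e)"
    by (rule sum_mset_nonneg_real) (simp add: power_sum_coeff_nonneg)
  moreover have "power_sum_coeff (k # I) (mset (k # I)) = ?f k + (\<Sum>e\<in>#mset I. ?f e)"
    by (simp only: power_sum_coeff.simps mset.simps image_mset_add_mset sum_mset.add_mset)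
  ultimately show ?case using Cons by linarith
qed simp

text \<open>The terms of the coproduct of p_I, the product over the parts k of (p_k tensor 1) + (1
  tensor p_k): each part goes left or right. A list keeps the multiplicities that equal parts
  cause.\<close>

primrec splits :: "'a list \<Rightarrow> ('a list \<times> 'a list) list" where
  "splits [] = [([], [])]"
| "splits (k # I) = map (\<lambda>(A, B). (k # A, B)) (splits I) @ map (\<lambda>(A, B). (A, k # B)) (splits I)"

lemma lower_add_left: "e \<in># E \<Longrightarrow> lower k e (E + F) = lower k e E + F"
  by (simp add: lower_def)

lemma lower_add_right: "e \<in># F \<Longrightarrow> lower k e (E + F) = E + lower k e F"
  by (simp add: lower_def)

text \<open>
  The coproduct formula for products of primitive elements, read off on the coefficients:
  concatenating exponent sequences adds their multisets.
\<close>

lemma power_sum_coeff_add: "power_sum_coeff I (E + F) = (\<Sum>(A, B)\<leftarrow>splits I. power_sum_coeff A E * power_sum_coeff B F)"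
proof (induction I arbitrary: E F)
  case Nil
  show ?case by simp
next
  case (Cons k I)
  have left: "(\<Sum>e\<in>#E. if k \<le> e then \<Sum>(A, B)\<leftarrow>xs. power_sum_coeff A (lower k e E) * power_sum_coeff B F else 0)
      = (\<Sum>(A, B)\<leftarrow>xs. power_sum_coeff (k # A) E * power_sum_coeff B F)" for xs
  proof (induction xs)
    case (Cons x xs)
    have "(\<Sum>e\<in>#E. if k \<le> e then \<Sum>(A, B)\<leftarrow>x # xs. power_sum_coeff A (lower k e E) * power_sum_coeff B F else 0)
        = (\<Sum>e\<in>#E. (if k \<le> e then power_sum_coeff (fst x) (lower k e E) else 0) * power_sum_coeff (snd x) F +
          (if k \<le> e then (\<Sum>(A, B)\<leftarrow>xs. power_sum_coeff A (lower k e E) * power_sum_coeff B F) else 0))"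
      by (rule arg_cong[where f = sum_mset], rule image_mset_cong) (simp add: case_prod_unfold)
    with Cons show ?case
      by (simp add: sum_mset.distrib sum_mset_distrib_right case_prod_unfold)
  qed (simp cong: if_cong)
  have right: "(\<Sum>e\<in>#F. if k \<le> e then \<Sum>(A, B)\<leftarrow>xs. power_sum_coeff A E * power_sum_coeff B (lower k e F) else 0)
      = (\<Sum>(A, B)\<leftarrow>xs. power_sum_coeff A E * power_sum_coeff (k # B) F)" for xs
  proof (induction xs)
    case (Cons x xs)
    have "(\<Sum>e\<in>#F. if k \<le> e then \<Sum>(A, B)\<leftarrow>x # xs. power_sum_coeff A E * power_sum_coeff B (lower k e F) else 0)
        = (\<Sum>e\<in>#F. power_sum_coeff (fst x) E * (if k \<le> e then power_sum_coeff (snd x) (lower k e F) else 0) +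
          (if k \<le> e then (\<Sum>(A, B)\<leftarrow>xs. power_sum_coeff A E * power_sum_coeff B (lower k e F)) else 0))"
      by (rule arg_cong[where f = sum_mset], rule image_mset_cong) (simp add: case_prod_unfold)
    with Cons show ?case
      by (simp add: sum_mset.distrib sum_mset_distrib_left case_prod_unfold)
  qed (simp cong: if_cong)
  have "power_sum_coeff (k # I) (E + F) =
      (\<Sum>e\<in>#E. if k \<le> e then power_sum_coeff I (lower k e (E + F)) else 0) +
      (\<Sum>e\<in>#F. if k \<le> e then power_sum_coeff I (lower k e (E + F)) else 0)"
    by simp
  also have "(\<Sum>e\<in>#E. if k \<le> e then power_sum_coeff I (lower k e (E + F)) else 0) =
      (\<Sum>(A, B)\<leftarrow>splits I. power_sum_coeff (k # A) E * power_sum_coeff B F)"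
    unfolding left[symmetric] Cons.IH[symmetric]
    by (rule arg_cong[where f = sum_mset], rule image_mset_cong) (simp add: lower_add_left)
  also have "(\<Sum>e\<in>#F. if k \<le> e then power_sum_coeff I (lower k e (E + F)) else 0) =
      (\<Sum>(A, B)\<leftarrow>splits I. power_sum_coeff A E * power_sum_coeff (k # B) F)"
    unfolding right[symmetric] Cons.IH[symmetric]
    by (rule arg_cong[where f = sum_mset], rule image_mset_cong) (simp add: lower_add_right)
  finally show ?case by (simp add: o_def case_prod_unfold)
qed

lemma set_splitsD:
  assumes "(A, B) \<in> set (splits I)" and "I \<in> all_compositions"
  shows "A \<in> all_compositions" and "B \<in> all_compositions" and "sum_list A + sum_list B = sum_list I"
proof -
  have "A \<in> all_compositions \<and> B \<in> all_compositions \<and> sum_list A + sum_list B = sum_list I"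
    using assms by (induction I arbitrary: A B) auto
  then show "A \<in> all_compositions" and "B \<in> all_compositions" and "sum_list A + sum_list B = sum_list I"
    by auto
qed

lemma power_sum_splits:
  "(A, B) \<in> set (splits I) \<Longrightarrow> power_sum A * power_sum B = power_sum I"
proof (induction I arbitrary: A B)
  case (Cons k I)
  from Cons.prems consider A' where "A = k # A'" "(A', B) \<in> set (splits I)"
    | B' where "B = k # B'" "(A, B') \<in> set (splits I)" by auto
  then show ?case
    by cases (use Cons.IH in \<open>simp add: power_sum_Cons mult.assoc,
      metis mult.left_commute power_sum_Cons\<close>)
qed simp

text \<open>Binomial theorem over the parts: a part sent left weighs 1, a part sent right weighs r.
  If r is the base of the eigenvalue for one tensor factor fewer, the base grows by 1, so that a
  factors give a^l.\<close>

lemma sum_splits_power: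
  fixes r :: real
  shows "(\<Sum>(A, B)\<leftarrow>splits I. r ^ length B) = (1 + r) ^ length I"
proof (induction I)
  case (Cons k I)
  have "(\<Sum>p\<leftarrow>splits I. r * r ^ length (snd p)) = r * (\<Sum>p\<leftarrow>splits I. r ^ length (snd p))"
    by (simp add: sum_list_const_mult)
  with Cons show ?case by (simp add: o_def case_prod_unfold algebra_simps)
qed simp

lemma partition_eqI:
  assumes "I \<in> all_partitions" and "J \<in> all_partitions" and "mset I = mset J"
  shows "I = J"
proof -
  have "sort K = rev K" if "K \<in> all_partitions" for K
    using that by (intro properties_for_sort) (simp_all add: all_partitions_def sorted_wrt_rev)
  then have "rev I = rev J"
    using assms by (metis sorted_list_of_multiset_mset)
  then show ?thesis by simp
qed

text \<open>In a relation take L of maximal length with nonzero coefficient. At a monomial with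
  exponents L, a p_J of no greater length contributes only if J has the parts of L, which isolates
  the coefficient of L. Comparing lengths works in all degrees at once.\<close>

lemma power_sum_independent:
  shows "inj_on power_sum all_partitions" and "independent (power_sum ` all_partitions)"
proof -
  have *: "\<forall>J\<in>A. c J = 0"
    if A: "finite A" "A \<subseteq> all_partitions" and 0: "(\<Sum>J\<in>A. c J *\<^sub>R power_sum J) = 0" for A c
  proof (rule ccontr)
    let ?B = "{J \<in> A. c J \<noteq> 0}"
    assume "\<not> (\<forall>J\<in>A. c J = 0)"
    then have "finite (length ` ?B)" "length ` ?B \<noteq> {}" using A(1) by auto
    from Max_in[OF this] obtain L where L: "L \<in> ?B" "length L = Max (length ` ?B)" by auto
    then have max: "length J \<le> length L" if "J \<in> ?B" for J
      using that A(1) by simp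
    have comp: "J \<in> all_compositions" if "J \<in> A" for J
      using A(2) that by (auto simp: all_partitions_def)
    obtain m where m: "exponents m = L" using L comp exponents_surj by blast
    have "coeff (\<Sum>J\<in>A. c J *\<^sub>R power_sum J) m = (\<Sum>J\<in>A. if J = L then c L * power_sum_coeff L (mset L) else 0)"
      unfolding coeff_sum
    proof (rule sum.cong[OF refl])
      fix J assume J: "J \<in> A"
      have "J = L" if "c J \<noteq> 0" "power_sum_coeff J (mset L) \<noteq> 0"
      proof -
        have "mset L = mset J" using max that J by (intro power_sum_coeff_size) auto
        then show ?thesis using J L A(2) by (intro partition_eqI) auto
      qed
      then show "coeff (c J *\<^sub>R power_sum J) m = (if J = L then c L * power_sum_coeff L (mset L) else 0)"
        using J comp m by (auto simp: coeff_power_sum)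
    qed
    also have "\<dots> = c L * power_sum_coeff L (mset L)" using L A(1) by simp
    finally show False using 0 L power_sum_coeff_mset_pos[of L] by simp
  qed
  show "inj_on power_sum all_partitions" "independent (power_sum ` all_partitions)"
    using independent_familyI[of all_partitions power_sum] * by blast+
qed

section \<open>Complete homogeneous symmetric functions\<close>

lemma coeff_complete_hom_single:
  "coeff (complete_hom [k]) m = (if sum_list (exponents m) = k then 1 else 0)"
proof -
  have "{m' \<in> {m. (\<Sum>i\<in>Poly_Mapping.keys m. Poly_Mapping.lookup m i) = k}. m' = m}
      = (if sum_list (exponents m) = k then {m} else {})"
    by (auto simp: sum_list_exponents[OF finite_keys subset_refl])
  then show ?thesis by (simp add: complete_hom_def coeff_formal_sum)
qed

lemma complete_hom_Nil [simp]: "complete_hom [] = 1"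
  by (simp add: complete_hom_def)

lemma complete_hom_append: "complete_hom (I @ J) = complete_hom I * complete_hom J"
  by (simp add: complete_hom_def)

lemma complete_hom_Cons: "complete_hom (k # J) = complete_hom [k] * complete_hom J"
  by (simp add: complete_hom_def)

lemma complete_hom_cong: "mset I = mset J \<Longrightarrow> complete_hom I = complete_hom J"
  unfolding complete_hom_def by (simp only: prod_mset_prod_list[symmetric] mset_map)

lemma complete_hom_0: "complete_hom [0] = 1"
proof (rule mpser_eqI)
  fix m
  have "sum_list (exponents m) = 0 \<longleftrightarrow> m = 0"
    using sum_list_0_composition[OF exponents_in_all_compositions, of m] by simp
  then show "coeff (complete_hom [0]) m = coeff 1 m"
    by (simp add: coeff_complete_hom_single coeff_one)
qed

section \<open>Newton's identities and the span of the h\<close>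

lemma coeff_power_sum_mult_complete_hom:
  assumes "0 < k" "k \<le> n"
  shows "coeff (power_sum [k] * complete_hom [n - k]) m =
    (\<Sum>i\<in>Poly_Mapping.keys m. if sum_list (exponents m) = n \<and> k \<le> Poly_Mapping.lookup m i then 1 else 0)"
proof -
  have deg: "sum_list (exponents (m - Poly_Mapping.single i k)) + k = sum_list (exponents m)"
    if "k \<le> Poly_Mapping.lookup m i" for i
  proof -
    have "m = (m - Poly_Mapping.single i k) + Poly_Mapping.single i k"
      using that by (intro poly_mapping_eqI) (auto simp: lookup_add lookup_minus lookup_single when_def)
    then have "sum_list (exponents m) = sum_list (exponents (m - Poly_Mapping.single i k))
        + sum_list (exponents (Poly_Mapping.single i k))"
      by (metis sum_list_exponents_add)
    then show ?thesis by (simp add: sum_list_exponents[of "{i}"])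
  qed
  have "power_sum [k] = formal_sum UNIV (\<lambda>i. Poly_Mapping.single i k)"
    by (simp add: power_sum_Cons)
  moreover have "coeff (complete_hom [n - k]) (m - Poly_Mapping.single i k)
      = (if sum_list (exponents m) = n then 1 else 0)" if "k \<le> Poly_Mapping.lookup m i" for i
    using deg[OF that] assms(2) by (auto simp: coeff_complete_hom_single)
  ultimately show ?thesis
    using assms(1) by (simp add: coeff_power_sum_mult cong: if_cong)
qed

text \<open>Both sides vanish off degree n. At m of degree n the product p_k h_(n-k) counts the
  variables with exponent at least k, so the right-hand side counts pairs (i, k) with 1 \<le> k
  \<le> m_i, and their number is the sum of the m_i, which is n.\<close>

lemma newton_identity:
  "real n *\<^sub>R complete_hom [n] = (\<Sum>k=1..n. power_sum [k] * complete_hom [n - k])"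
proof (rule mpser_eqI)
  fix m :: monomial
  let ?K = "Poly_Mapping.keys m"
  have "coeff (\<Sum>k=1..n. power_sum [k] * complete_hom [n - k]) m
      = (\<Sum>k=1..n. \<Sum>i\<in>?K. if sum_list (exponents m) = n \<and> k \<le> Poly_Mapping.lookup m i then 1 else 0)"
    unfolding coeff_sum by (intro sum.cong refl coeff_power_sum_mult_complete_hom) auto
  also have "\<dots> = (if sum_list (exponents m) = n then real n else 0)"
  proof (cases "sum_list (exponents m) = n")
    case True
    then have n: "n = (\<Sum>i\<in>?K. Poly_Mapping.lookup m i)"
      by (simp add: sum_list_exponents[OF finite_keys subset_refl])
    have "(\<Sum>k=1..n. \<Sum>i\<in>?K. if sum_list (exponents m) = n \<and> k \<le> Poly_Mapping.lookup m i then 1 else 0)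
        = (\<Sum>i\<in>?K. \<Sum>k=1..n. if k \<le> Poly_Mapping.lookup m i then 1 else (0::real))"
      using True by (subst sum.swap) simp
    also have "\<dots> = (\<Sum>i\<in>?K. real (Poly_Mapping.lookup m i))"
    proof (rule sum.cong[OF refl])
      fix i assume "i \<in> ?K"
      \<comment> \<open>No exponent exceeds n, so the range of k loses none of the pairs.\<close>
      then have "Poly_Mapping.lookup m i \<le> n" unfolding n by (intro member_le_sum) auto
      then have "{1..n} \<inter> {k. k \<le> Poly_Mapping.lookup m i} = {1..Poly_Mapping.lookup m i}" by auto
      then show "(\<Sum>k=1..n. if k \<le> Poly_Mapping.lookup m i then 1 else (0::real)) = real (Poly_Mapping.lookup m i)"
        by (simp add: sum.If_cases)
    qed
    also have "\<dots> = real n" by (simp add: n)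
    finally show ?thesis using True by simp
  qed simp
  finally show "coeff (real n *\<^sub>R complete_hom [n]) m
      = coeff (\<Sum>k=1..n. power_sum [k] * complete_hom [n - k]) m"
    by (simp add: coeff_complete_hom_single)
qed

text \<open>The symmetric functions of degree n. The generators are indexed by compositions, with
  repetitions, because concatenation multiplies the h; \<open>hom_space_eq_partitions\<close>
  returns to partitions.\<close>

definition hom_space :: "nat \<Rightarrow> mpser set" where
  "hom_space n = span (complete_hom ` compositions n)"

lemma complete_hom_in_hom_space: "J \<in> compositions n \<Longrightarrow> complete_hom J \<in> hom_space n"
  by (auto simp: hom_space_def intro: span_base)

lemma hom_space_mult:
  assumes "f \<in> hom_space j" and "g \<in> hom_space k"
  shows "f * g \<in> hom_space (j + k)"
proof -
  obtain c where f: "f = (\<Sum>I\<in>compositions j. c I *\<^sub>R complete_hom I)"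
    using assms(1) unfolding hom_space_def by (rule span_familyE) simp
  obtain d where g: "g = (\<Sum>J\<in>compositions k. d J *\<^sub>R complete_hom J)"
    using assms(2) unfolding hom_space_def by (rule span_familyE) simp
  have "f * g = (\<Sum>I\<in>compositions j. \<Sum>J\<in>compositions k. (c I * d J) *\<^sub>R complete_hom (I @ J))"
    by (simp add: f g sum_product complete_hom_append mult.commute)
  also have "\<dots> \<in> hom_space (j + k)"
    unfolding hom_space_def
    by (intro span_sum span_scale span_base imageI) (auto simp: mem_compositions)
  finally show ?thesis .
qed

text \<open>Newton's identity is solved for p_n, which occurs in the term k = n with factor h_0 =
  1.\<close>

lemma power_sum_single_in_hom_space: "0 < n \<Longrightarrow> power_sum [n] \<in> hom_space n"
proof (induction n rule: less_induct)
  case (less n)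
  have "real n *\<^sub>R complete_hom [n] = power_sum [n] * complete_hom [0]
      + (\<Sum>k\<in>{1..n} - {n}. power_sum [k] * complete_hom [n - k])"
    using less.prems by (subst newton_identity, subst sum.remove[of _ n]) auto
  then have "power_sum [n] = real n *\<^sub>R complete_hom [n]
      - (\<Sum>k\<in>{1..n} - {n}. power_sum [k] * complete_hom [n - k])"
    by (simp add: complete_hom_0)
  also have "\<dots> \<in> hom_space n"
    unfolding hom_space_def
  proof (intro span_diff span_scale span_sum, fold hom_space_def)
    show "complete_hom [n] \<in> hom_space n"
      using less.prems by (intro complete_hom_in_hom_space) (simp add: mem_compositions)
    fix k assume k: "k \<in> {1..n} - {n}"
    then have "power_sum [k] \<in> hom_space k" by (intro less.IH) auto
    moreover have "complete_hom [n - k] \<in> hom_space (n - k)"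
      using k by (intro complete_hom_in_hom_space) (auto simp: mem_compositions)
    ultimately have "power_sum [k] * complete_hom [n - k] \<in> hom_space (k + (n - k))"
      by (rule hom_space_mult)
    then show "power_sum [k] * complete_hom [n - k] \<in> hom_space n" using k by simp
  qed
  finally show ?case .
qed

lemma power_sum_in_hom_space: "I \<in> all_compositions \<Longrightarrow> power_sum I \<in> hom_space (sum_list I)"
proof (induction I)
  case Nil
  show ?case using complete_hom_in_hom_space[of "[]" 0] by (simp add: mem_compositions)
next
  case (Cons k I)
  then have "power_sum [k] * power_sum I \<in> hom_space (k + sum_list I)"
    by (intro hom_space_mult power_sum_single_in_hom_space) auto
  then show ?case by (simp add: power_sum_Cons)
qed

section \<open>Partitions as indices and independence of the h\<close>

lemma partition_of_composition:
  assumes "J \<in> all_compositions"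
  obtains L where "L \<in> all_partitions" and "mset L = mset J" and "sum_list L = sum_list J"
proof
  show m: "mset (rev (sort J)) = mset J" by simp
  show "rev (sort J) \<in> all_partitions"
    using assms by (simp add: all_partitions_def all_compositions_def sorted_wrt_rev)
  show "sum_list (rev (sort J)) = sum_list J"
    by (metis m sum_mset_sum_list)
qed

lemma partitions_subset: "partitions n \<subseteq> compositions n" "partitions n \<subseteq> all_partitions"
  by (auto simp: partitions_def all_partitions_def mem_compositions)

lemma finite_partitions [simp]: "finite (partitions n)"
  by (rule finite_subset[OF partitions_subset(1)]) simp

lemma hom_space_eq_partitions: "hom_space n = span (complete_hom ` partitions n)"
proof -
  have "complete_hom J \<in> complete_hom ` partitions n" if "J \<in> compositions n" for J
  proof -
    from that have "J \<in> all_compositions" by (simp add: mem_compositions)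
    then obtain L where L: "L \<in> all_partitions" "mset L = mset J" "sum_list L = sum_list J"
      by (rule partition_of_composition)
    then have "L \<in> partitions n" using that by (simp add: partitions_def mem_compositions)
    then show ?thesis using complete_hom_cong[OF L(2)] by (metis image_eqI)
  qed
  then have "complete_hom ` compositions n = complete_hom ` partitions n"
    using partitions_subset by blast
  then show ?thesis by (simp add: hom_space_def)
qed

text \<open>The exchange argument needs finitely many vectors, so the relation is placed in the set
  \<open>S\<close> of all partitions of size at most N. With a partition \<open>S\<close> contains
  all others of its size, so its p lie in the span of its h, and the p are already
  independent.\<close>

lemma complete_hom_independent:
  shows "inj_on complete_hom all_partitions" and "independent (complete_hom ` all_partitions)"
proof -
  have *: "\<forall>J\<in>A. c J = 0"
    if A: "finite A" "A \<subseteq> all_partitions" and 0: "(\<Sum>J\<in>A. c J *\<^sub>R complete_hom J) = 0" for A c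
  proof
    fix J assume J: "J \<in> A"
    define N where "N = (\<Sum>L\<in>A. sum_list L)"
    define S where "S = {L \<in> all_partitions. sum_list L \<le> N}"
    have "finite S"
      by (rule finite_subset[OF _ finite_compositions_le[of N]]) (auto simp: S_def all_partitions_def)
    have S: "S \<subseteq> all_partitions" by (auto simp: S_def)
    have "sum_list L \<le> N" if "L \<in> A" for L
      unfolding N_def using that A(1) by (intro member_le_sum) auto
    then have AS: "A \<subseteq> S" using A(2) by (auto simp: S_def)
    have p: "inj_on power_sum S" "independent (power_sum ` S)"
      using power_sum_independent S
      by (auto intro: inj_on_subset dependent_mono[OF _ image_mono])
    have "power_sum ` S \<subseteq> span (complete_hom ` S)"
    proof clarify
      fix L assume L: "L \<in> S"
      have "partitions (sum_list L) \<subseteq> S"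
        using L by (auto simp: S_def partitions_def)
      then have "hom_space (sum_list L) \<subseteq> span (complete_hom ` S)"
        unfolding hom_space_eq_partitions by (intro span_mono image_mono)
      then show "power_sum L \<in> span (complete_hom ` S)"
        using power_sum_in_hom_space[of L] L by (auto simp: S_def all_partitions_def)
    qed
    from independent_family_of_spanning[OF \<open>finite S\<close> p this]
    have h: "inj_on complete_hom S" "independent (complete_hom ` S)" by auto
    show "c J = 0"
      using representation_family[OF h A(1) AS, of J c] J AS 0
      by (auto simp: representation_zero)
  qed
  show "inj_on complete_hom all_partitions" "independent (complete_hom ` all_partitions)"
    using independent_familyI[of all_partitions complete_hom] * by blast+
qed

section \<open>The Hall inner product with a power sum\<close>

lemma coeff_monomial_sym:
  "coeff (monomial_sym L) m = (if mset (exponents m) = mset L then 1 else 0)"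
proof -
  have "{m' \<in> {m. image_mset (Poly_Mapping.lookup m) (mset_set (Poly_Mapping.keys m)) = mset L}. m' = m}
      = (if mset (exponents m) = mset L then {m} else {})"
    by (auto simp: mset_exponents)
  then show ?thesis by (simp add: monomial_sym_def coeff_formal_sum)
qed

lemma monomial_sym_independent:
  shows "inj_on monomial_sym all_partitions" and "independent (monomial_sym ` all_partitions)"
proof -
  have *: "\<forall>J\<in>A. c J = 0"
    if A: "finite A" "A \<subseteq> all_partitions" and 0: "(\<Sum>J\<in>A. c J *\<^sub>R monomial_sym J) = 0" for A c
  proof
    fix J assume J: "J \<in> A"
    then have "J \<in> all_compositions" using A(2) by (auto simp: all_partitions_def)
    then obtain m where m: "exponents m = J" using exponents_surj by blast
    have "coeff (\<Sum>J\<in>A. c J *\<^sub>R monomial_sym J) m = (\<Sum>K\<in>A. if K = J then c J else 0)"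
      unfolding coeff_sum
    proof (rule sum.cong[OF refl])
      fix K assume "K \<in> A"
      then have "mset J = mset K \<longleftrightarrow> K = J" using J A(2) partition_eqI by blast
      then show "coeff (c K *\<^sub>R monomial_sym K) m = (if K = J then c J else 0)"
        by (simp add: coeff_monomial_sym m)
    qed
    then show "c J = 0" using 0 J A(1) by simp
  qed
  show "inj_on monomial_sym all_partitions" "independent (monomial_sym ` all_partitions)"
    using independent_familyI[of all_partitions monomial_sym] * by blast+
qed

lemma power_sum_monomial_expansion:
  assumes "I \<in> compositions n"
  shows "power_sum I = (\<Sum>L\<in>partitions n. power_sum_coeff I (mset L) *\<^sub>R monomial_sym L)"
proof (rule mpser_eqI)
  fix m
  have I: "I \<in> all_compositions" "sum_list I = n" using assms by (auto simp: mem_compositions)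
  obtain L0 where L0: "L0 \<in> all_partitions" "mset L0 = mset (exponents m)" "sum_list L0 = sum_list (exponents m)"
    using partition_of_composition[OF exponents_in_all_compositions] by blast
  have "coeff (\<Sum>L\<in>partitions n. power_sum_coeff I (mset L) *\<^sub>R monomial_sym L) m
      = (\<Sum>L\<in>partitions n. if L = L0 then power_sum_coeff I (mset L0) else 0)"
    unfolding coeff_sum
  proof (rule sum.cong[OF refl])
    fix L assume "L \<in> partitions n"
    then have "mset (exponents m) = mset L \<longleftrightarrow> L = L0"
      using L0 partition_eqI[of L L0] partitions_subset(2)[of n] by auto
    then show "coeff (power_sum_coeff I (mset L) *\<^sub>R monomial_sym L) m = (if L = L0 then power_sum_coeff I (mset L0) else 0)"
      by (simp add: coeff_monomial_sym)
  qed
  also have "\<dots> = power_sum_coeff I (mset L0)"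
  proof (cases "L0 \<in> partitions n")
    case False
    then have "sum_mset (mset L0) \<noteq> sum_list I"
      using L0(1) I by (auto simp: partitions_def sum_mset_sum_list)
    then have "power_sum_coeff I (mset L0) = 0" using power_sum_coeff_degree by blast
    then show ?thesis by simp
  qed simp
  finally show "coeff (power_sum I) m = coeff (\<Sum>L\<in>partitions n. power_sum_coeff I (mset L) *\<^sub>R monomial_sym L) m"
    using I by (simp add: coeff_power_sum L0)
qed

text \<open>Duality of m and h: the m coefficients of p_I meet the h coefficients of the second
  argument. Independence of both families lets the nested linear extensions be evaluated.\<close>

lemma hall_inner_power_sum:
  assumes "I \<in> compositions n"
  shows "hall_inner (power_sum I) (\<Sum>M\<in>partitions n. d M *\<^sub>R complete_hom M)
    = (\<Sum>L\<in>partitions n. power_sum_coeff I (mset L) * d L)"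
proof -
  have "hall_inner (power_sum I) (\<Sum>M\<in>partitions n. d M *\<^sub>R complete_hom M)
      = (\<Sum>L\<in>partitions n. power_sum_coeff I (mset L) * (\<Sum>M\<in>partitions n. d M * (if L = M then 1 else 0)))"
    unfolding hall_inner_def power_sum_monomial_expansion[OF assms]
    by (simp add: linear_extension_sum[OF monomial_sym_independent _ partitions_subset(2)]
        linear_extension_sum[OF complete_hom_independent _ partitions_subset(2)])
  then show ?thesis by (simp add: if_distrib[of "(*) _"] cong: if_cong)
qed

text \<open>\<open>linear_extension\<close> obeys linearity only inside the span of the h, hence the
  membership in \<open>hom_space n\<close>.\<close>

lemma hall_inner_power_sum_sum:
  assumes "I \<in> compositions n" and "finite A" and "\<And>K. K \<in> A \<Longrightarrow> g K \<in> hom_space n"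
  shows "hall_inner (power_sum I) (\<Sum>K\<in>A. g K) = (\<Sum>K\<in>A. hall_inner (power_sum I) (g K))"
proof -
  have "\<exists>d. g K = (\<Sum>M\<in>partitions n. d M *\<^sub>R complete_hom M)" if "K \<in> A" for K
    using assms(3)[OF that] unfolding hom_space_eq_partitions by (auto elim: span_familyE)
  then obtain d where d: "\<And>K. K \<in> A \<Longrightarrow> g K = (\<Sum>M\<in>partitions n. d K M *\<^sub>R complete_hom M)"
    by metis
  have "(\<Sum>K\<in>A. g K) = (\<Sum>M\<in>partitions n. (\<Sum>K\<in>A. d K M) *\<^sub>R complete_hom M)"
    using d by (simp add: scaleR_left.sum, subst sum.swap) simp
  then show ?thesis
    using d by (simp add: hall_inner_power_sum[OF assms(1)] sum_distrib_left, subst sum.swap) simp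
qed

text \<open>h_J is the h of the partition that sorts J. The pairing picks the coefficient of p_I
  there, which is also its M_J coefficient.\<close>

lemma hall_inner_power_sum_complete_hom:
  assumes "I \<in> compositions n" and "J \<in> compositions n"
  shows "hall_inner (power_sum I) (complete_hom J) = power_sum_coeff I (mset J)"
proof -
  from assms(2) have "J \<in> all_compositions" by (simp add: mem_compositions)
  then obtain L where L: "L \<in> all_partitions" "mset L = mset J" "sum_list L = sum_list J"
    by (rule partition_of_composition)
  then have "L \<in> partitions n" using assms(2) by (simp add: partitions_def mem_compositions)
  then have "complete_hom J = (\<Sum>M\<in>partitions n. (if M = L then 1 else 0) *\<^sub>R complete_hom M)"
    using complete_hom_cong[OF L(2)] by (simp add: if_distrib[of "\<lambda>x. x *\<^sub>R _"] cong: if_cong)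
  then show ?thesis
    using \<open>L \<in> partitions n\<close> L(2)
    by (simp add: hall_inner_power_sum[OF assms(1)] if_distrib[of "(*) _"] cong: if_cong)
qed

section \<open>Ribbon Schur functions as generating functions of words\<close>

definition content :: "nat list \<Rightarrow> monomial" where
  "content w = (\<Sum>x\<leftarrow>w. Poly_Mapping.single x 1)"

lemma content_Nil [simp]: "content [] = 0"
  by (simp add: content_def)

lemma content_append: "content (u @ w) = content u + content w"
  by (simp add: content_def)

lemma content_Cons: "content (x # w) = Poly_Mapping.single x 1 + content w"
  by (simp add: content_def)

lemma lookup_content: "Poly_Mapping.lookup (content w) i = count (mset w) i"
  by (induction w) (auto simp: content_Cons lookup_add lookup_single when_def)

lemma content_eq_iff: "content u = content w \<longleftrightarrow> mset u = mset w"
  by (metis lookup_content multiset_eqI poly_mapping_eqI)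

lemma length_content: "sum_list (exponents (content w)) = length w"
proof (induction w)
  case (Cons x w)
  have "sum_list (exponents (Poly_Mapping.single x 1)) = 1"
    by (simp add: sum_list_exponents[of "{x}"])
  with Cons show ?case by (simp add: content_Cons sum_list_exponents_add)
qed (simp add: exponents_def)

lemma finite_content: "finite {w \<in> A. content w = m}"
proof (cases "\<exists>w0. content w0 = m")
  case True
  then obtain w0 where w0: "content w0 = m" by blast
  have "{w \<in> A. content w = m} \<subseteq> {w. set w \<subseteq> set w0 \<and> length w = length w0}"
  proof
    fix w assume "w \<in> {w \<in> A. content w = m}"
    then have "mset w = mset w0" using w0 content_eq_iff[of w w0] by simp
    then have "set w = set w0" "length w = length w0"
      by (rule mset_eq_setD, rule mset_eq_length)
    then show "w \<in> {w. set w \<subseteq> set w0 \<and> length w = length w0}" by simp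
  qed
  then show ?thesis by (rule finite_subset) (simp add: finite_lists_length_eq)
qed auto

text \<open>A monomial has exactly one weakly increasing word. With words for h as well as for
  ribbons, their products become concatenations.\<close>

lemma complete_hom_single_words:
  "complete_hom [k] = formal_sum {w. sorted w \<and> length w = k} content"
proof (rule mpser_eqI)
  fix m :: monomial
  have "finite {x. 0 < Poly_Mapping.lookup m x}"
    using finite_keys[of m] by (rule rev_finite_subset) (auto simp: in_keys_iff)
  then have count: "count (Abs_multiset (Poly_Mapping.lookup m)) = Poly_Mapping.lookup m"
    by (rule count_Abs_multiset)
  define v where "v = sorted_list_of_multiset (Abs_multiset (Poly_Mapping.lookup m))"
  have v: "sorted v" "content v = m"
    by (auto simp: v_def lookup_content count intro: poly_mapping_eqI)
  have "w = v" if "sorted w" "content w = m" for w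
  proof -
    have "mset w = mset v" using that v(2) content_eq_iff[of w v] by simp
    then have "sort w = sort v" by (metis sorted_list_of_multiset_mset)
    then show ?thesis using that(1) v(1) by (simp add: sorted_sort_id)
  qed
  then have "{w \<in> {w. sorted w \<and> length w = k}. content w = m} = {w. w = v \<and> length v = k}"
    using v by blast
  also have "\<dots> = (if sum_list (exponents m) = k then {v} else {})"
    unfolding v(2)[symmetric] length_content by auto
  finally have "{w \<in> {w. sorted w \<and> length w = k}. content w = m}
      = (if sum_list (exponents m) = k then {v} else {})" .
  then show "coeff (complete_hom [k]) m = coeff (formal_sum {w. sorted w \<and> length w = k} content) m"
    by (simp add: coeff_complete_hom_single coeff_formal_sum)
qed

text \<open>The set also contains 0 and the total sum; for a word of that length,
  \<open>descents_at\<close> asks only about positions strictly between them.\<close>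

definition breaks :: "nat list \<Rightarrow> nat set" where
  "breaks J = range (\<lambda>k. sum_list (take k J))"

lemma breaks_Nil [simp]: "breaks [] = {0}"
  by (auto simp: breaks_def)

lemma breaks_Cons: "breaks (j # J) = insert 0 ((+) j ` breaks J)"
proof -
  have "range f = insert (f 0) (range (\<lambda>k. f (Suc k)))" for f :: "nat \<Rightarrow> nat"
  proof safe
    fix n assume "f n \<notin> range (\<lambda>k. f (Suc k))"
    then show "f n = f 0" by (cases n) auto
  qed auto
  from this[of "\<lambda>k. sum_list (take k (j # J))"] show ?thesis
    by (simp add: breaks_def image_image)
qed

text \<open>
  Reading a filling of a ribbon from the bottom left to the top right box gives a word;
  semistandardness prescribes where this word descends.
\<close>

definition descents_at :: "nat set \<Rightarrow> nat list \<Rightarrow> bool" where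
  "descents_at B w \<longleftrightarrow>
     (\<forall>i. Suc i < length w \<longrightarrow> (if Suc i \<in> B then w ! Suc i < w ! i else w ! i \<le> w ! Suc i))"

definition ribbon_words :: "nat list \<Rightarrow> nat list set" where
  "ribbon_words J = {w. length w = sum_list J \<and> descents_at (breaks J) w}"

lemma descents_at_cong:
  assumes "\<And>i. 0 < i \<Longrightarrow> i < length w \<Longrightarrow> i \<in> B \<longleftrightarrow> i \<in> C"
  shows "descents_at B w \<longleftrightarrow> descents_at C w"
  unfolding descents_at_def using assms by auto

lemma descents_at_empty: "descents_at {} w \<longleftrightarrow> sorted w"
  by (simp add: descents_at_def sorted_iff_nth_Suc)

lemma descents_at_append:
  assumes "u \<noteq> []" and "w \<noteq> []"
  shows "descents_at B (u @ w) \<longleftrightarrow> descents_at B u \<and> descents_at {i. length u + i \<in> B} w \<and>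
    (if length u \<in> B then hd w < last u else last u \<le> hd w)" (is "?L \<longleftrightarrow> ?R")
proof -
  let ?P = "\<lambda>i. if Suc i \<in> B then (u @ w) ! Suc i < (u @ w) ! i else (u @ w) ! i \<le> (u @ w) ! Suc i"
  have left: "?P i \<longleftrightarrow> (if Suc i \<in> B then u ! Suc i < u ! i else u ! i \<le> u ! Suc i)"
    if "Suc i < length u" for i
    using that by (simp add: nth_append)
  have right: "?P (length u + i) \<longleftrightarrow>
      (if Suc i \<in> {i. length u + i \<in> B} then w ! Suc i < w ! i else w ! i \<le> w ! Suc i)" for i
    by (simp add: nth_append)
  have mid: "?P (length u - 1) \<longleftrightarrow> (if length u \<in> B then hd w < last u else last u \<le> hd w)"
    using assms by (simp add: nth_append last_conv_nth hd_conv_nth)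
  show ?thesis
  proof
    assume ?L
    then have P: "?P i" if "Suc i < length u + length w" for i
      using that by (simp add: descents_at_def)
    show ?R
    proof (intro conjI)
      show "descents_at B u"
        unfolding descents_at_def
      proof (intro allI impI)
        fix i assume i: "Suc i < length u"
        then have "?P i" by (intro P) simp
        then show "if Suc i \<in> B then u ! Suc i < u ! i else u ! i \<le> u ! Suc i"
          using left[OF i] by blast
      qed
      show "descents_at {i. length u + i \<in> B} w"
        unfolding descents_at_def
      proof (intro allI impI)
        fix i assume "Suc i < length w"
        then have "?P (length u + i)" by (intro P) simp
        then show "if Suc i \<in> {i. length u + i \<in> B} then w ! Suc i < w ! i else w ! i \<le> w ! Suc i"
          using right by blast
      qed
      have "?P (length u - 1)" using assms by (intro P) (cases u; cases w; simp)
      then show "if length u \<in> B then hd w < last u else last u \<le> hd w" using mid by blast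
    qed
  next
    assume R: ?R
    show ?L
      unfolding descents_at_def
    proof (intro allI impI)
      fix i assume i: "Suc i < length (u @ w)"
      consider "Suc i < length u" | "Suc i = length u" | i' where "i = length u + i'"
        by (metis not_less_eq not_less_iff_gr_or_eq less_imp_Suc_add add_Suc_right add_Suc_shift le_add_diff_inverse linorder_not_less)
      then show "?P i"
      proof cases
        case 1
        moreover have "descents_at B u" using R by blast
        ultimately show ?thesis unfolding descents_at_def using left by blast
      next
        case 2
        then have i: "i = length u - 1" by simp
        have "if length u \<in> B then hd w < last u else last u \<le> hd w" using R by blast
        then show ?thesis unfolding i using mid by blast
      next
        case 3
        then have "Suc i' < length w" using i by simp
        moreover have "descents_at {i. length u + i \<in> B} w" using R by blast
        ultimately show ?thesis unfolding 3 descents_at_def using right by blast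
      qed
    qed
  qed
qed

text \<open>The ribbon Schur function through reading words: products are handled by cutting words,
  and \<open>skew_schur_ribbon_shape\<close> brings back the tableaux.\<close>

definition ribbon_schur :: "nat list \<Rightarrow> mpser" where
  "ribbon_schur J = formal_sum (ribbon_words J) content"

lemma ribbon_schur_Nil: "ribbon_schur [] = 1"
proof (rule mpser_eqI)
  fix m
  have "{w \<in> ribbon_words []. content w = m} = (if m = 0 then {[]} else {})"
    by (auto simp: ribbon_words_def descents_at_def)
  then show "coeff (ribbon_schur []) m = coeff 1 m"
    by (simp add: ribbon_schur_def coeff_formal_sum coeff_one)
qed

lemma ribbon_schur_single: "ribbon_schur [j] = complete_hom [j]"
proof -
  have "descents_at (breaks [j]) w \<longleftrightarrow> sorted w" if "length w = j" for w
    using that descents_at_cong[of w "breaks [j]" "{}"] by (auto simp: breaks_Cons descents_at_empty)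
  then have "ribbon_words [j] = {w. sorted w \<and> length w = j}"
    by (auto simp: ribbon_words_def)
  then show ?thesis by (simp add: ribbon_schur_def complete_hom_single_words)
qed

text \<open>
  Gluing a weakly increasing word to the front of a ribbon word creates a descent at the joint or
  none; these are the two ribbons in which the new row is attached below, or to the left of, the
  first one.
\<close>

lemma complete_hom_mult_ribbon_schur:
  assumes "0 < j" and "0 < k"
  shows "complete_hom [j] * ribbon_schur (k # K) = ribbon_schur (j # k # K) + ribbon_schur ((j + k) # K)"
proof -
  let ?U = "{u. sorted u \<and> length u = j}" and ?W = "ribbon_words (k # K)"
  let ?V1 = "ribbon_words (j # k # K)" and ?V2 = "ribbon_words ((j + k) # K)"
  have V1: "u @ w \<in> ?V1 \<longleftrightarrow> u \<in> ?U \<and> w \<in> ?W \<and> hd w < last u"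
    if "length u = j" "length w = k + sum_list K" for u w
  proof -
    have "u \<noteq> []" "w \<noteq> []" using that assms by auto
    moreover have "descents_at (breaks (j # k # K)) u \<longleftrightarrow> sorted u"
      unfolding descents_at_empty[symmetric] using that by (intro descents_at_cong) (auto simp: breaks_Cons)
    moreover have "descents_at {i. length u + i \<in> breaks (j # k # K)} w \<longleftrightarrow> descents_at (breaks (k # K)) w"
      using that by (intro descents_at_cong) (auto simp: breaks_Cons)
    moreover have "j \<in> breaks (j # k # K)" by (simp add: breaks_Cons)
    ultimately show ?thesis
      using that by (auto simp: ribbon_words_def descents_at_append)
  qed
  have V2: "u @ w \<in> ?V2 \<longleftrightarrow> u \<in> ?U \<and> w \<in> ?W \<and> last u \<le> hd w"
    if "length u = j" "length w = k + sum_list K" for u w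
  proof -
    have "u \<noteq> []" "w \<noteq> []" using that assms by auto
    moreover have "descents_at (breaks ((j + k) # K)) u \<longleftrightarrow> sorted u"
      unfolding descents_at_empty[symmetric] using that by (intro descents_at_cong) (auto simp: breaks_Cons)
    moreover have "descents_at {i. length u + i \<in> breaks ((j + k) # K)} w \<longleftrightarrow> descents_at (breaks (k # K)) w"
      using that assms by (intro descents_at_cong) (auto simp: breaks_Cons add.assoc)
    moreover have "j \<notin> breaks ((j + k) # K)" using assms by (auto simp: breaks_Cons)
    ultimately show ?thesis
      using that by (auto simp: ribbon_words_def descents_at_append)
  qed
  have len: "length w = k + sum_list K" if "w \<in> ?W" for w
    using that by (simp add: ribbon_words_def)
  have V: "v \<in> ?V1 \<union> ?V2 \<Longrightarrow> length v = j + k + sum_list K" for v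
    by (auto simp: ribbon_words_def)
  have split: "take j v \<in> ?U \<and> drop j v \<in> ?W" if "v \<in> ?V1 \<union> ?V2" for v
    using that V1[of "take j v" "drop j v"] V2[of "take j v" "drop j v"] V[OF that] by auto
  have bij: "bij_betw (\<lambda>(u, w). u @ w) (?U \<times> ?W) (?V1 \<union> ?V2)"
  proof (rule bij_betw_byWitness[where f' = "\<lambda>v. (take j v, drop j v)"])
    show "(\<lambda>(u, w). u @ w) ` (?U \<times> ?W) \<subseteq> ?V1 \<union> ?V2"
    proof
      fix v assume "v \<in> (\<lambda>(u, w). u @ w) ` (?U \<times> ?W)"
      then obtain u w where v: "v = u @ w" "u \<in> ?U" "w \<in> ?W" by auto
      then have "length u = j" "length w = k + sum_list K" using len by auto
      from V1[OF this] V2[OF this] v show "v \<in> ?V1 \<union> ?V2"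
        by (metis UnI1 UnI2 not_le)
    qed
    show "(\<lambda>v. (take j v, drop j v)) ` (?V1 \<union> ?V2) \<subseteq> ?U \<times> ?W"
      using split by blast
  qed auto
  have disj: "?V1 \<inter> ?V2 = {}"
  proof -
    have "v \<notin> ?V2" if v: "v \<in> ?V1" for v
      using v V1[of "take j v" "drop j v"] V2[of "take j v" "drop j v"] V[of v] by auto
    then show ?thesis by blast
  qed
  have "complete_hom [j] * ribbon_schur (k # K) = formal_sum (?U \<times> ?W) (\<lambda>(u, w). content u + content w)"
    unfolding complete_hom_single_words ribbon_schur_def
    by (rule formal_sum_mult) (simp_all only: finite_content)
  also have "\<dots> = formal_sum (?V1 \<union> ?V2) content"
    using bij by (rule formal_sum_reindex) (auto simp: content_append)
  also have "\<dots> = ribbon_schur (j # k # K) + ribbon_schur ((j + k) # K)"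
    unfolding ribbon_schur_def using disj by (intro formal_sum_Un finite_content)
  finally show ?thesis .
qed

section \<open>Complete functions as sums of ribbons over coarsenings\<close>

lemma coarsenings_Cons:
  assumes "0 < j" and "J \<in> all_compositions" and "J \<noteq> []"
  defines "R \<equiv> {K \<in> compositions (sum_list J). refines J K}"
  shows "{K \<in> compositions (sum_list (j # J)). refines (j # J) K}
    = (#) j ` R \<union> (\<lambda>K. (j + hd K) # tl K) ` R" (is "?L = ?R")
proof
  have jJ: "j # J \<in> all_compositions" using assms by simp
  have hd: "K = hd K # tl K" "0 < hd K" if "K \<in> R" for K
  proof -
    have "K \<noteq> []"
      using that assms(2,3) sum_list_0_composition[of J] by (auto simp: R_def mem_compositions)
    then show "K = hd K # tl K" "0 < hd K"
      using that by (cases K; simp add: R_def mem_compositions)+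
  qed
  show "?L \<subseteq> ?R"
  proof
    fix K assume K: "K \<in> ?L"
    then have Kc: "K \<in> all_compositions" "sum_list K = j + sum_list J" by (auto simp: mem_compositions)
    from K refines_Cons[OF jJ Kc(1)]
    consider K0 where "K = j # K0" "refines J K0"
      | k K0 where "0 < k" "K = (j + k) # K0" "refines J (k # K0)" by blast
    then show "K \<in> ?R"
    proof cases
      case 1
      then show ?thesis using Kc by (auto simp: R_def mem_compositions)
    next
      case 2
      then have "k # K0 \<in> R" using Kc by (auto simp: R_def mem_compositions)
      then have "(\<lambda>K. (j + hd K) # tl K) (k # K0) \<in> (\<lambda>K. (j + hd K) # tl K) ` R"
        by (rule imageI)
      then show ?thesis using 2 by simp
    qed
  qed
  show "?R \<subseteq> ?L"
  proof (rule Un_least)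
    show "(#) j ` R \<subseteq> ?L"
      using assms(1) by (auto simp: R_def mem_compositions refines_Cons[OF jJ])
    show "(\<lambda>K. (j + hd K) # tl K) ` R \<subseteq> ?L"
    proof clarify
      fix K assume K: "K \<in> R"
      obtain k K0 where k: "K = k # K0" "0 < k" using hd[OF K] by metis
      then have "(j + k) # K0 \<in> all_compositions" "refines J (k # K0)" "k + sum_list K0 = sum_list J"
        using K by (auto simp: R_def mem_compositions)
      then show "(j + hd K) # tl K \<in> compositions (sum_list (j # J)) \<and> refines (j # J) ((j + hd K) # tl K)"
        using k refines_Cons[OF jJ, of "(j + k) # K0"] by (auto simp: mem_compositions)
    qed
  qed
qed

text \<open>Multiplication by h_j sends each coarsening K of J to the two coarsenings of
  \<open>j # J\<close> that put j before K or merge it into the first part of K. Both maps are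
  injective, their images are disjoint, and together they exhaust the coarsenings.\<close>

lemma complete_hom_eq_sum_ribbon_schur:
  "J \<in> all_compositions \<Longrightarrow>
    complete_hom J = (\<Sum>K | K \<in> compositions (sum_list J) \<and> refines J K. ribbon_schur K)"
proof (induction J)
  case Nil
  have "{K. K \<in> compositions 0 \<and> refines [] K} = {[]}"
    by (auto simp: mem_compositions refines_Nil)
  then show ?case by (simp add: ribbon_schur_Nil)
next
  case (Cons j J)
  then have j: "0 < j" and J: "J \<in> all_compositions" by auto
  show ?case
  proof (cases "J = []")
    \<comment> \<open>The product rule attaches j to an existing first row, so a single part is
      treated by itself.\<close>
    case True
    have "refines [j] K \<longleftrightarrow> K = [j]" if "K \<in> all_compositions" for K
      using refines_Cons[of j "[]" K] that j by (auto simp: refines_Nil)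
    then have "{K. K \<in> compositions j \<and> refines [j] K} = {[j]}"
      using j by (auto simp: mem_compositions)
    then show ?thesis using True by (simp add: ribbon_schur_single)
  next
    case False
    define R where "R = {K \<in> compositions (sum_list J). refines J K}"
    have fin: "finite R" by (simp add: R_def)
    have hd: "K = hd K # tl K \<and> 0 < hd K" if "K \<in> R" for K
    proof -
      have "K \<noteq> []"
        using that J False sum_list_0_composition[of J] by (auto simp: R_def mem_compositions)
      then show ?thesis using that by (cases K) (auto simp: R_def mem_compositions)
    qed
    have inj: "inj_on (\<lambda>K. (j + hd K) # tl K) R"
      using hd by (intro inj_onI) (metis add_left_cancel list.inject)
    \<comment> \<open>The first part equals j in one image and exceeds j in the other.\<close>
    have disj: "(#) j ` R \<inter> (\<lambda>K. (j + hd K) # tl K) ` R = {}"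
      using hd by force
    have "complete_hom (j # J) = complete_hom [j] * (\<Sum>K\<in>R. ribbon_schur K)"
      using Cons.IH[OF J] by (simp add: complete_hom_Cons[of j J] R_def)
    also have "\<dots> = (\<Sum>K\<in>R. complete_hom [j] * ribbon_schur (hd K # tl K))"
      using hd by (simp add: sum_distrib_left)
    also have "\<dots> = (\<Sum>K\<in>R. ribbon_schur (j # K) + ribbon_schur ((j + hd K) # tl K))"
    proof (rule sum.cong[OF refl])
      fix K assume "K \<in> R"
      with hd j complete_hom_mult_ribbon_schur[of j "hd K" "tl K"]
      show "complete_hom [j] * ribbon_schur (hd K # tl K)
          = ribbon_schur (j # K) + ribbon_schur ((j + hd K) # tl K)" by metis
    qed
    also have "\<dots> = (\<Sum>K\<in>(#) j ` R. ribbon_schur K) + (\<Sum>K\<in>(\<lambda>K. (j + hd K) # tl K) ` R. ribbon_schur K)"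
      using inj by (simp add: sum.distrib sum.reindex)
    also have "\<dots> = (\<Sum>K\<in>(#) j ` R \<union> (\<lambda>K. (j + hd K) # tl K) ` R. ribbon_schur K)"
      using fin disj by (intro sum.union_disjoint[symmetric]) auto
    finally show ?thesis
      using coarsenings_Cons[OF j J False] by (simp add: R_def)
  qed
qed

text \<open>In the expansion of h_J every other ribbon belongs to a proper coarsening, which is
  shorter. The symmetry of ribbon functions, not visible on words, is obtained here.\<close>

lemma ribbon_schur_in_hom_space:
  assumes "J \<in> compositions n"
  shows "ribbon_schur J \<in> hom_space n"
  using assms
proof (induction "length J" arbitrary: J rule: less_induct)
  case less
  let ?R = "{K \<in> compositions n. refines J K}"
  have n: "sum_list J = n" "J \<in> all_compositions" using less.prems by (auto simp: mem_compositions)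
  have J: "J \<in> ?R" using less.prems by (simp add: refines_refl)
  have "complete_hom J = ribbon_schur J + (\<Sum>K\<in>?R - {J}. ribbon_schur K)"
    unfolding complete_hom_eq_sum_ribbon_schur[OF n(2)] n(1) using J by (intro sum.remove) auto
  then have "ribbon_schur J = complete_hom J - (\<Sum>K\<in>?R - {J}. ribbon_schur K)" by simp
  also have "\<dots> \<in> hom_space n"
    unfolding hom_space_def
  proof (intro span_diff span_sum, fold hom_space_def)
    fix K assume K: "K \<in> ?R - {J}"
    then have "K \<in> all_compositions" by (auto simp: mem_compositions)
    with K n have "length K < length J"
      using refines_length[of J K] by force
    then show "ribbon_schur K \<in> hom_space n"
      using K by (intro less.hyps) auto
  qed (use less.prems in \<open>auto intro: complete_hom_in_hom_space\<close>)
  finally show ?case .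
qed

section \<open>Reading ribbon tableaux as words\<close>

lemma psum_eq:
  assumes "J \<in> all_compositions" and "k \<le> length J"
  shows "(\<Sum>s<k. J ! s - 1) + k = sum_list (take k J)"
  using assms(2)
proof (induction k)
  case (Suc k)
  \<comment> \<open>Positive parts make the truncated subtraction in \<open>J ! k - 1\<close>
    exact.\<close>
  then have "0 < J ! k" using assms(1) by (auto simp: all_compositions_def)
  then show ?case using Suc by (simp add: take_Suc_conv_app_nth)
qed simp

lemma psum_mono: "k \<le> l \<Longrightarrow> sum_list (take k J) \<le> sum_list (take l (J :: nat list))"
  by (metis le_Suc_ex le_add1 sum_list_append take_add)

text \<open>Each row starts in the last column of the row below, so one column is lost per row and
  row k from below starts in column P k - k. Adding the height k to the column turns the rows into
  consecutive intervals.\<close>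

lemma ribbon_shape_index:
  assumes "J \<in> all_compositions"
  defines "P \<equiv> \<lambda>k. sum_list (take k J)" and "l \<equiv> length J"
  shows "ribbon_shape J = {(r, c). r < l \<and> P (l - 1 - r) \<le> l - 1 - r + c \<and> l - 1 - r + c < P (l - r)}"
proof -
  have P: "(\<Sum>s<k. J ! s - 1) \<le> c \<and> c < (\<Sum>s<k. J ! s - 1) + J ! k \<longleftrightarrow>
      P k \<le> k + c \<and> k + c < P (Suc k)" if "k < l" for k c
    using psum_eq[OF assms(1), of k] that by (auto simp: P_def l_def take_Suc_conv_app_nth)
  have 1: "(r, c) \<in> ribbon_shape J \<longleftrightarrow> (\<exists>k<l. r = l - 1 - k \<and> P k \<le> k + c \<and> k + c < P (Suc k))" for r c
    unfolding ribbon_shape_def using P by (auto simp: l_def)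
  have 2: "(\<exists>k<l. r = l - 1 - k \<and> P k \<le> k + c \<and> k + c < P (Suc k)) \<longleftrightarrow> r < l \<and> P (l - 1 - r) \<le> l - 1 - r + c \<and> l - 1 - r + c < P (Suc (l - 1 - r))" for r c
  proof
    assume "\<exists>k<l. r = l - 1 - k \<and> P k \<le> k + c \<and> k + c < P (Suc k)"
    then obtain k where k: "k < l" "r = l - 1 - k" "P k \<le> k + c" "k + c < P (Suc k)" by blast
    then have "l - 1 - r = k" "r < l" by auto
    then show "r < l \<and> P (l - 1 - r) \<le> l - 1 - r + c \<and> l - 1 - r + c < P (Suc (l - 1 - r))"
      using k by simp
  next
    assume "r < l \<and> P (l - 1 - r) \<le> l - 1 - r + c \<and> l - 1 - r + c < P (Suc (l - 1 - r))"
    then show "\<exists>k<l. r = l - 1 - k \<and> P k \<le> k + c \<and> k + c < P (Suc k)"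
      by (intro exI[of _ "l - 1 - r"]) auto
  qed
  have "Suc (l - 1 - r) = l - r" if "r < l" for r
    using that by simp
  then show ?thesis unfolding set_eq_iff split_paired_All using 1 2 by auto
qed

text \<open>Position of a box on the walk from bottom left to top right: the height of its row plus
  its column. A step to the right or upwards adds 1.\<close>

definition box_index :: "nat list \<Rightarrow> nat \<times> nat \<Rightarrow> nat" where
  "box_index J = (\<lambda>(r, c). length J - 1 - r + c)"

lemma row_exists:
  fixes J :: "nat list"
  assumes "i < sum_list J"
  obtains k where "k < length J" and "sum_list (take k J) \<le> i" and "i < sum_list (take (Suc k) J)"
proof -
  have "\<exists>k<length J. (\<forall>j\<le>k. \<not> i < sum_list (take j J)) \<and> i < sum_list (take (Suc k) J)"
    using ex_least_nat_less[of "\<lambda>k. i < sum_list (take k J)" "length J"] assms by simp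
  then obtain k where "k < length J" "\<forall>j\<le>k. \<not> i < sum_list (take j J)" "i < sum_list (take (Suc k) J)"
    by blast
  with that show thesis by (metis order_refl not_less)
qed

lemma row_unique:
  fixes J :: "nat list"
  assumes "sum_list (take k J) \<le> i" "i < sum_list (take (Suc k) J)"
    and "sum_list (take k' J) \<le> i" "i < sum_list (take (Suc k') J)"
  shows "k = k'"
proof -
  have "\<not> k < k'" if "i < sum_list (take (Suc k) J)" "sum_list (take k' J) \<le> i" for k k'
    using psum_mono[of "Suc k" k' J] that by auto
  with assms show ?thesis by (meson linorder_neqE_nat)
qed

lemma mem_ribbon_shape:
  assumes "J \<in> all_compositions" and "k < length J"
  shows "(length J - 1 - k, c) \<in> ribbon_shape J \<longleftrightarrow>
    sum_list (take k J) \<le> k + c \<and> k + c < sum_list (take (Suc k) J)"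
proof -
  have "length J - 1 - (length J - 1 - k) = k" "length J - (length J - 1 - k) = Suc k"
    using assms(2) by auto
  then show ?thesis
    using assms(2) unfolding ribbon_shape_index[OF assms(1)] by auto
qed

lemma ribbon_shapeE:
  assumes "J \<in> all_compositions" and "b \<in> ribbon_shape J"
  obtains k c where "k < length J" and "b = (length J - 1 - k, c)" and "box_index J b = k + c"
    and "sum_list (take k J) \<le> k + c" and "k + c < sum_list (take (Suc k) J)"
proof -
  from assms(2) obtain k c where k: "k < length J" "b = (length J - 1 - k, c)"
    unfolding ribbon_shape_def by auto
  with that[of k c] mem_ribbon_shape[OF assms(1) k(1), of c] assms(2)
  show thesis by (simp add: box_index_def)
qed

lemma box_index_bij:
  assumes "J \<in> all_compositions"
  shows "bij_betw (box_index J) (ribbon_shape J) {..<sum_list J}"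
  unfolding bij_betw_def
proof
  show "inj_on (box_index J) (ribbon_shape J)"
  proof (rule inj_onI)
    fix b b' assume "b \<in> ribbon_shape J" "b' \<in> ribbon_shape J" and eq: "box_index J b = box_index J b'"
    from assms this(1) obtain k c where k: "b = (length J - 1 - k, c)" "box_index J b = k + c"
      "sum_list (take k J) \<le> k + c" "k + c < sum_list (take (Suc k) J)" by (rule ribbon_shapeE)
    from assms \<open>b' \<in> _\<close> obtain k' c' where k': "b' = (length J - 1 - k', c')" "box_index J b' = k' + c'"
      "sum_list (take k' J) \<le> k' + c'" "k' + c' < sum_list (take (Suc k') J)" by (rule ribbon_shapeE)
    have e: "k + c = k' + c'" using eq k k' by simp
    have "k = k'" using k(3,4) k'(3,4) unfolding e by (rule row_unique)
    then show "b = b'" using e k k' by simp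
  qed
  show "box_index J ` ribbon_shape J = {..<sum_list J}"
  proof
    show "box_index J ` ribbon_shape J \<subseteq> {..<sum_list J}"
    proof (rule image_subsetI)
      fix b assume "b \<in> ribbon_shape J"
      with assms obtain k c where "box_index J b = k + c" "k + c < sum_list (take (Suc k) J)"
        "k < length J" by (rule ribbon_shapeE)
      then show "box_index J b \<in> {..<sum_list J}"
        using psum_mono[of "Suc k" "length J" J] by simp
    qed
    show "{..<sum_list J} \<subseteq> box_index J ` ribbon_shape J"
    proof
      fix i assume "i \<in> {..<sum_list J}"
      then have "i < sum_list J" by simp
      then obtain k where k: "k < length J" "sum_list (take k J) \<le> i" "i < sum_list (take (Suc k) J)"
        by (rule row_exists)
      then have "k \<le> i" using psum_eq[OF assms, of k] by simp
      then have "(length J - 1 - k, i - k) \<in> ribbon_shape J"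
        "box_index J (length J - 1 - k, i - k) = i"
        using k mem_ribbon_shape[OF assms k(1), of "i - k"] by (auto simp: box_index_def)
      then show "i \<in> box_index J ` ribbon_shape J" by (metis image_eqI)
    qed
  qed
qed

text \<open>Neighbours in a row are consecutive positions inside one part; neighbours in a column
  are consecutive positions with a break between them. The upper box comes later in the word, so
  increase down a column is a descent.\<close>

lemma semistandard_ribbon_iff:
  assumes J: "J \<in> all_compositions" and len: "length w = sum_list J"
    and T: "\<And>b. b \<in> ribbon_shape J \<Longrightarrow> T b = w ! box_index J b"
  shows "semistandard (ribbon_shape J) T \<longleftrightarrow> descents_at (breaks J) w"
proof
  assume S: "semistandard (ribbon_shape J) T"
  show "descents_at (breaks J) w"
    unfolding descents_at_def
  proof (intro allI impI)
    fix i assume i: "Suc i < length w"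
    then have "i < sum_list J" using len by simp
    then obtain k where k: "k < length J" "sum_list (take k J) \<le> i" "i < sum_list (take (Suc k) J)"
      by (rule row_exists)
    then have ki: "k \<le> i" using psum_eq[OF J, of k] by simp
    let ?b = "(length J - 1 - k, i - k)"
    have b: "?b \<in> ribbon_shape J" using mem_ribbon_shape[OF J k(1), of "i - k"] k ki by simp
    have b_idx: "box_index J ?b = i" using k ki by (simp add: box_index_def)
    show "if Suc i \<in> breaks J then w ! Suc i < w ! i else w ! i \<le> w ! Suc i"
    \<comment> \<open>The box at position \<open>Suc i\<close> follows in the same row, or box i
      ends its row and the next one lies directly above it.\<close>
    proof (cases "Suc i < sum_list (take (Suc k) J)")
      case True
      have "Suc i \<notin> breaks J"
      proof
        assume "Suc i \<in> breaks J"
        then obtain k' where k': "Suc i = sum_list (take k' J)" by (auto simp: breaks_def)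
        then show False
          using psum_mono[of k' k J] psum_mono[of "Suc k" k' J] True k by (cases "k' \<le> k") auto
      qed
      moreover have b': "(length J - 1 - k, Suc (i - k)) \<in> ribbon_shape J"
        using mem_ribbon_shape[OF J k(1), of "Suc (i - k)"] k ki True by simp
      moreover have "box_index J (length J - 1 - k, Suc (i - k)) = Suc i"
        using k ki by (simp add: box_index_def)
      moreover have "T ?b \<le> T (length J - 1 - k, Suc (i - k))"
        using S b b' unfolding semistandard_def by blast
      ultimately show ?thesis using T b b_idx by simp
    next
      case False
      then have eq: "Suc i = sum_list (take (Suc k) J)" using k by simp
      then have "Suc i \<in> breaks J" by (auto simp: breaks_def)
      \<comment> \<open>\<open>Suc i\<close> is still a position of the word, so row k is not the
        top row.\<close>
      have k1: "Suc k < length J"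
        using eq i len k(1) by (cases "Suc k = length J") auto
      then have "0 < J ! Suc k" using J by (auto simp: all_compositions_def)
      then have "Suc i < sum_list (take (Suc (Suc k)) J)"
        using eq k1 by (simp add: take_Suc_conv_app_nth)
      then have b': "(length J - 1 - Suc k, i - k) \<in> ribbon_shape J"
        using mem_ribbon_shape[OF J k1, of "i - k"] eq ki by simp
      have b'_idx: "box_index J (length J - 1 - Suc k, i - k) = Suc i"
        using k1 ki by (simp add: box_index_def)
      have "Suc (length J - 1 - Suc k) = length J - 1 - k" using k1 by simp
      then have "T (length J - 1 - Suc k, i - k) < T ?b"
        using S b b' unfolding semistandard_def by metis
      then show ?thesis using T b b' b_idx b'_idx \<open>Suc i \<in> breaks J\<close> by simp
    qed
  qed
next
  assume W: "descents_at (breaks J) w"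
  have bound: "box_index J b < length w" if "b \<in> ribbon_shape J" for b
    using box_index_bij[OF J] that len by (auto simp: bij_betw_def)
  show "semistandard (ribbon_shape J) T"
    unfolding semistandard_def
  proof (intro conjI allI impI)
    fix r c assume "(r, c) \<in> ribbon_shape J \<and> (r, Suc c) \<in> ribbon_shape J"
    then have b: "(r, c) \<in> ribbon_shape J" and b': "(r, Suc c) \<in> ribbon_shape J" by auto
    from J b obtain k c0 where k: "k < length J" "(r, c) = (length J - 1 - k, c0)"
      "box_index J (r, c) = k + c0" "sum_list (take k J) \<le> k + c0" by (rule ribbon_shapeE)
    have idx': "box_index J (r, Suc c) = Suc (k + c)" using k by (simp add: box_index_def)
    have lt: "Suc (k + c) < sum_list (take (Suc k) J)"
      using b' k mem_ribbon_shape[OF J k(1), of "Suc c"] by simp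
    have "Suc (k + c) \<notin> breaks J"
    proof
      assume "Suc (k + c) \<in> breaks J"
      then obtain k' where "Suc (k + c) = sum_list (take k' J)" by (auto simp: breaks_def)
      then show False
        using psum_mono[of k' k J] psum_mono[of "Suc k" k' J] lt k by (cases "k' \<le> k") auto
    qed
    then have "w ! (k + c) \<le> w ! Suc (k + c)"
      using W bound[OF b'] idx' unfolding descents_at_def by metis
    then show "T (r, c) \<le> T (r, Suc c)" using T[OF b] T[OF b'] k idx' by simp
  next
    fix r c assume "(r, c) \<in> ribbon_shape J \<and> (Suc r, c) \<in> ribbon_shape J"
    then have b: "(r, c) \<in> ribbon_shape J" and b': "(Suc r, c) \<in> ribbon_shape J" by auto
    from J b' obtain k c0 where k: "k < length J" "(Suc r, c) = (length J - 1 - k, c0)"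
      "box_index J (Suc r, c) = k + c0" "k + c0 < sum_list (take (Suc k) J)" by (rule ribbon_shapeE)
    have k1: "Suc k < length J" "r = length J - 1 - Suc k" using k by auto
    have "sum_list (take (Suc k) J) \<le> Suc k + c"
      using b mem_ribbon_shape[OF J k1(1), of c] k1 by simp
    then have "Suc (k + c) = sum_list (take (Suc k) J)" using k by simp
    then have "Suc (k + c) \<in> breaks J" by (auto simp: breaks_def)
    moreover have idx: "box_index J (r, c) = Suc (k + c)" using k1 by (simp add: box_index_def)
    ultimately have "w ! Suc (k + c) < w ! (k + c)"
      using W bound[OF b] unfolding descents_at_def by metis
    then show "T (r, c) < T (Suc r, c)" using T[OF b] T[OF b'] k idx by simp
  qed
qed

lemma content_eq_sum: "content w = (\<Sum>i<length w. Poly_Mapping.single (w ! i) 1)"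
  by (simp add: content_def sum_list_sum_nth atLeast0LessThan)

text \<open>Reading the boxes by index is a bijection from fillings to words:
  \<open>extensional\<close> fixes the values off the shape, so a word determines its
  filling.\<close>

lemma skew_schur_ribbon_shape:
  assumes "J \<in> all_compositions"
  shows "skew_schur (ribbon_shape J) = ribbon_schur J"
proof -
  let ?D = "ribbon_shape J" and ?n = "sum_list J"
  define box where "box = inv_into ?D (box_index J)"
  note bij = box_index_bij[OF assms]
  have box: "box (box_index J b) = b" if "b \<in> ?D" for b
    unfolding box_def using bij that by (simp add: bij_betw_def)
  have box': "box i \<in> ?D" "box_index J (box i) = i" if "i < ?n" for i
    unfolding box_def using bij that by (auto simp: bij_betw_def inv_into_into f_inv_into_f)
  have idx: "box_index J b < ?n" if "b \<in> ?D" for b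
    using bij that by (auto simp: bij_betw_def)
  let ?word = "\<lambda>T. map (\<lambda>i. T (box i)) [0..<?n]"
  have T: "T b = ?word T ! box_index J b" if "b \<in> ?D" for T :: "nat \<times> nat \<Rightarrow> nat" and b
    using box[OF that] idx[OF that] by simp
  have "bij_betw ?word {T \<in> extensional ?D. semistandard ?D T} (ribbon_words J)"
  proof (rule bij_betw_byWitness[where f' = "\<lambda>w. restrict (\<lambda>b. w ! box_index J b) ?D"])
    show "\<forall>T\<in>{T \<in> extensional ?D. semistandard ?D T}.
        restrict (\<lambda>b. ?word T ! box_index J b) ?D = T"
    proof
      fix T assume "T \<in> {T \<in> extensional ?D. semistandard ?D T}"
      then have "T \<in> extensional ?D" by simp
      then show "restrict (\<lambda>b. ?word T ! box_index J b) ?D = T"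
        by (rule extensionalityI[OF restrict_extensional]) (simp only: restrict_apply' T[symmetric])
    qed
    show "\<forall>w\<in>ribbon_words J. ?word (restrict (\<lambda>b. w ! box_index J b) ?D) = w"
      by (auto simp: ribbon_words_def box' intro!: nth_equalityI)
    show "?word ` {T \<in> extensional ?D. semistandard ?D T} \<subseteq> ribbon_words J"
    proof clarify
      fix T assume "semistandard ?D T"
      then have "descents_at (breaks J) (?word T)"
        using semistandard_ribbon_iff[OF assms _ T] by simp
      then show "?word T \<in> ribbon_words J" by (simp add: ribbon_words_def)
    qed
    show "(\<lambda>w. restrict (\<lambda>b. w ! box_index J b) ?D) ` ribbon_words J
        \<subseteq> {T \<in> extensional ?D. semistandard ?D T}"
    proof clarify
      fix w assume "w \<in> ribbon_words J"
      then have "length w = sum_list J" "descents_at (breaks J) w" by (auto simp: ribbon_words_def)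
      then show "restrict (\<lambda>b. w ! box_index J b) ?D \<in> extensional ?D \<and>
          semistandard ?D (restrict (\<lambda>b. w ! box_index J b) ?D)"
        using semistandard_ribbon_iff[OF assms, of w "restrict (\<lambda>b. w ! box_index J b) ?D"] by simp
    qed
  qed
  moreover have "content (?word T) = (\<Sum>b\<in>?D. Poly_Mapping.single (T b) 1)" for T :: "nat \<times> nat \<Rightarrow> nat"
  proof -
    have "content (?word T) = (\<Sum>i<?n. Poly_Mapping.single (?word T ! i) 1)"
      by (simp add: content_eq_sum)
    also have "\<dots> = (\<Sum>b\<in>?D. Poly_Mapping.single (?word T ! box_index J b) 1)"
      by (rule sum.reindex_bij_betw[OF bij, symmetric])
    finally show ?thesis by (simp only: T[symmetric] cong: sum.cong)
  qed
  ultimately show ?thesis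
    unfolding skew_schur_def ribbon_schur_def by (rule formal_sum_reindex)
qed

section \<open>The Hopf-power map\<close>

lemma lookup_scaleR [simp]: "Poly_Mapping.lookup (c *\<^sub>R t) u = c *\<^sub>R Poly_Mapping.lookup t u"
  by (simp add: scaleR_poly_mapping.rep_eq)

text \<open>Linear extension from the basis of the free vector space.
  \<open>iterated_product\<close>, \<open>coproduct_last\<close> and tensoring with a basis element
  all have this form, so one proof of linearity covers them.\<close>

definition tens_lift :: "(nat list list \<Rightarrow> 'w::real_vector) \<Rightarrow> tens \<Rightarrow> 'w" where
  "tens_lift \<Phi> t = (\<Sum>u\<in>Poly_Mapping.keys t. Poly_Mapping.lookup t u *\<^sub>R \<Phi> u)"

lemma tens_lift_superset:
  assumes "finite U" and "Poly_Mapping.keys t \<subseteq> U"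
  shows "tens_lift \<Phi> t = (\<Sum>u\<in>U. Poly_Mapping.lookup t u *\<^sub>R \<Phi> u)"
  unfolding tens_lift_def using assms by (intro sum.mono_neutral_left) (auto simp: in_keys_iff)

lemma linear_tens_lift: "linear (tens_lift \<Phi>)"
proof (rule linearI)
  fix s t :: tens and c :: real
  let ?U = "Poly_Mapping.keys s \<union> Poly_Mapping.keys t"
  have "Poly_Mapping.keys (s + t) \<subseteq> ?U" by (rule Poly_Mapping.keys_add)
  then show "tens_lift \<Phi> (s + t) = tens_lift \<Phi> s + tens_lift \<Phi> t"
    by (simp add: tens_lift_superset[of ?U] lookup_add scaleR_add_left sum.distrib)
  have "Poly_Mapping.keys (c *\<^sub>R t) \<subseteq> Poly_Mapping.keys t" by (auto simp: in_keys_iff)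
  then show "tens_lift \<Phi> (c *\<^sub>R t) = c *\<^sub>R tens_lift \<Phi> t"
    by (simp add: tens_lift_superset[of "Poly_Mapping.keys t"] scaleR_sum_right)
qed

lemma tens_lift_single: "tens_lift \<Phi> (Poly_Mapping.single u 1) = \<Phi> u"
  by (simp add: tens_lift_def)

lemma iterated_product_eq: "iterated_product = tens_lift (\<lambda>u. prod_list (map M_qsym u))"
  by (simp add: fun_eq_iff iterated_product_def tens_lift_def)

lemma coproduct_last_eq:
  "coproduct_last = tens_lift (\<lambda>u. tensor (Poly_Mapping.single (butlast u) 1) (coproduct (M_qsym (last u))))"
  by (simp add: fun_eq_iff coproduct_last_def tens_lift_def)

lemma tensor_single: "tensor (Poly_Mapping.single x 1) t = tens_lift (\<lambda>v. Poly_Mapping.single (x @ v) 1) t"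
proof -
  have single: "Poly_Mapping.single v c = c *\<^sub>R Poly_Mapping.single v 1" for v :: "nat list list" and c :: real
    by (rule poly_mapping_eqI) (simp add: lookup_single when_def)
  have "tensor (Poly_Mapping.single x 1) t
      = (\<Sum>v\<in>Poly_Mapping.keys t. Poly_Mapping.single (x @ v) (Poly_Mapping.lookup t v))"
    by (simp add: tensor_def)
  also have "\<dots> = tens_lift (\<lambda>v. Poly_Mapping.single (x @ v) 1) t"
    unfolding tens_lift_def by (intro sum.cong refl single)
  finally show ?thesis .
qed

lemma coproduct_M_qsym:
  "J \<in> all_compositions \<Longrightarrow>
    coproduct (M_qsym J) = (\<Sum>j\<le>length J. Poly_Mapping.single [take j J, drop j J] 1)"
  unfolding coproduct_def by (rule linear_extension_base[OF M_qsym_independent])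

lemma coproduct_last_single:
  assumes "J \<in> all_compositions"
  shows "coproduct_last (Poly_Mapping.single (u @ [J]) 1) =
    (\<Sum>j\<le>length J. Poly_Mapping.single ((u @ [take j J]) @ [drop j J]) 1)"
  by (simp add: coproduct_last_eq tens_lift_single tensor_single coproduct_M_qsym[OF assms]
      linear_sum[OF linear_tens_lift])

text \<open>Index shift: \<open>psi a J\<close> is \<open>\<Psi>\<^bsup>a+1\<^esup>(M_J)\<close>.\<close>

fun psi :: "nat \<Rightarrow> nat list \<Rightarrow> mpser" where
  "psi 0 J = M_qsym J"
| "psi (Suc a) J = (\<Sum>j\<le>length J. M_qsym (take j J) * psi a (drop j J))"

lemma linear_coproduct_last_funpow: "linear (coproduct_last ^^ a)"
proof (induction a)
  case 0
  show ?case by (simp add: linear_iff)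
next
  case (Suc a)
  have "linear coproduct_last" unfolding coproduct_last_eq by (rule linear_tens_lift)
  from linear_compose[OF Suc this] show ?case by (simp only: funpow.simps)
qed

lemma linear_iterated_product: "linear iterated_product"
  unfolding iterated_product_eq by (rule linear_tens_lift)

lemma drop_composition: "J \<in> all_compositions \<Longrightarrow> drop j J \<in> all_compositions"
  by (auto simp: all_compositions_def dest: in_set_dropD)

lemma take_composition: "J \<in> all_compositions \<Longrightarrow> take j J \<in> all_compositions"
  by (auto simp: all_compositions_def dest: in_set_takeD)

text \<open>The coproduct acts on the last factor only, so the factors \<open>u\<close> in front are
  carried along until the final product. They vary in the induction because each step moves a piece
  of J into them.\<close>

lemma iterated_product_coproduct:
  assumes "J \<in> all_compositions"
  shows "iterated_product ((coproduct_last ^^ a) (Poly_Mapping.single (u @ [J]) 1))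
    = prod_list (map M_qsym u) * psi a J"
  using assms
proof (induction a arbitrary: u J)
  case 0
  show ?case by (simp add: iterated_product_eq tens_lift_single)
next
  case (Suc a)
  have "iterated_product ((coproduct_last ^^ Suc a) (Poly_Mapping.single (u @ [J]) 1))
      = iterated_product ((coproduct_last ^^ a)
          (\<Sum>j\<le>length J. Poly_Mapping.single ((u @ [take j J]) @ [drop j J]) 1))"
    \<comment> \<open>The innermost application is peeled off: it is the first coproduct that cuts
      J.\<close>
    unfolding funpow_Suc_right o_apply coproduct_last_single[OF Suc.prems] ..
  also have "\<dots> = (\<Sum>j\<le>length J. iterated_product ((coproduct_last ^^ a)
          (Poly_Mapping.single ((u @ [take j J]) @ [drop j J]) 1)))"
    by (simp only: linear_sum[OF linear_coproduct_last_funpow] linear_sum[OF linear_iterated_product])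
  also have "\<dots> = (\<Sum>j\<le>length J. prod_list (map M_qsym (u @ [take j J])) * psi a (drop j J))"
    by (intro sum.cong refl Suc.IH drop_composition Suc.prems)
  also have "\<dots> = prod_list (map M_qsym u) * psi (Suc a) J"
    by (simp add: sum_distrib_left mult.assoc)
  finally show ?case .
qed

lemma hopf_power_eq_psi:
  assumes "finite A" and "A \<subseteq> all_compositions"
  shows "hopf_power (Suc a) (\<Sum>J\<in>A. d J *\<^sub>R M_qsym J) = (\<Sum>J\<in>A. d J *\<^sub>R psi a J)"
proof -
  have "qsym_to_tens (\<Sum>J\<in>A. d J *\<^sub>R M_qsym J) = (\<Sum>J\<in>A. d J *\<^sub>R Poly_Mapping.single [J] 1)"
    unfolding qsym_to_tens_def by (rule linear_extension_sum[OF M_qsym_independent assms])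
  then have "hopf_power (Suc a) (\<Sum>J\<in>A. d J *\<^sub>R M_qsym J)
      = (\<Sum>J\<in>A. d J *\<^sub>R iterated_product ((coproduct_last ^^ a) (Poly_Mapping.single ([] @ [J]) 1)))"
    by (simp add: hopf_power_def iterated_coproduct_def
        linear_sum[OF linear_coproduct_last_funpow] linear_sum[OF linear_iterated_product]
        linear_scale[OF linear_coproduct_last_funpow] linear_scale[OF linear_iterated_product])
  also have "\<dots> = (\<Sum>J\<in>A. d J *\<^sub>R psi a J)"
    using assms(2) by (intro sum.cong refl) (simp only: iterated_product_coproduct subset_iff list.map prod_list.Nil mult_1)
  finally show ?thesis .
qed

text \<open>Psi preserves the degree. This makes the matrix entries true coefficients, since
  \<open>representation\<close> is 0 off the span.\<close>

lemma psi_in_span: "J \<in> compositions n \<Longrightarrow> psi a J \<in> span (M_qsym ` compositions n)"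
proof (induction a arbitrary: J n)
  case 0
  then show ?case by (auto intro: span_base)
next
  case (Suc a)
  then have J: "J \<in> all_compositions" "sum_list J = n" by (auto simp: mem_compositions)
  show ?case
    unfolding psi.simps
  proof (rule span_sum)
    fix j
    have n: "sum_list (take j J) + sum_list (drop j J) = n"
      using J(2) by (metis append_take_drop_id sum_list_append)
    have "M_qsym (take j J) \<in> span (M_qsym ` compositions (sum_list (take j J)))"
      using take_composition[OF J(1)] by (intro span_base imageI) (simp add: mem_compositions)
    moreover have "psi a (drop j J) \<in> span (M_qsym ` compositions (sum_list (drop j J)))"
      using drop_composition[OF J(1)] by (intro Suc.IH) (simp add: mem_compositions)
    ultimately show "M_qsym (take j J) * psi a (drop j J) \<in> span (M_qsym ` compositions n)"
      using M_qsym_span_mult n by metis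
  qed
qed

section \<open>Power sums as eigenvectors of Psi\<close>

lemma sum_product_sum_list:
  fixes u v :: "'a \<Rightarrow> 'v::real_algebra"
  shows "(\<Sum>X\<in>C. \<Sum>Y\<in>C. (\<Sum>(A, B)\<leftarrow>xs. f A X * g B Y) *\<^sub>R (u X * v Y))
    = (\<Sum>(A, B)\<leftarrow>xs. (\<Sum>X\<in>C. f A X *\<^sub>R u X) * (\<Sum>Y\<in>C. g B Y *\<^sub>R v Y))"
proof (induction xs)
  case (Cons x xs)
  have "(\<Sum>X\<in>C. \<Sum>Y\<in>C. (f (fst x) X * g (snd x) Y) *\<^sub>R (u X * v Y))
      = (\<Sum>X\<in>C. f (fst x) X *\<^sub>R u X) * (\<Sum>Y\<in>C. g (snd x) Y *\<^sub>R v Y)"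
    by (simp add: sum_product mult.commute)
  with Cons show ?case
    by (simp add: case_prod_unfold scaleR_add_left sum.distrib)
qed simp

lemma power_sum_M_qsym_expansion:
  assumes "I \<in> all_compositions" and "finite A" "A \<subseteq> all_compositions" and "compositions (sum_list I) \<subseteq> A"
  shows "power_sum I = (\<Sum>J\<in>A. power_sum_coeff I (mset J) *\<^sub>R M_qsym J)"
proof (rule quasisymmetric_expansion)
  show "coeff (power_sum I) m = power_sum_coeff I (mset (exponents m))" for m
    by (rule coeff_power_sum[OF assms(1)])
  fix J assume "J \<in> all_compositions" "power_sum_coeff I (mset J) \<noteq> 0"
  then show "J \<in> A"
    using power_sum_coeff_degree[of I "mset J"] assms(4) by (auto simp: mem_compositions sum_mset_sum_list)
qed (use assms in auto)

text \<open>Induction on the number of tensor factors: a cut distributes the coefficient of p_I over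
  the pairs (A, B) in \<open>splits I\<close>; the left pieces rebuild p_A, the right ones give a
  multiple of p_B, and p_A p_B is p_I. The bound N provides one index set for p_I and all p_A and
  p_B.\<close>

lemma psi_power_sum:
  assumes "I \<in> all_compositions" and "sum_list I \<le> N"
  shows "(\<Sum>J | J \<in> all_compositions \<and> sum_list J \<le> N. power_sum_coeff I (mset J) *\<^sub>R psi a J)
    = real (Suc a) ^ length I *\<^sub>R power_sum I"
  using assms
proof (induction a arbitrary: I)
  case 0
  have "power_sum I = (\<Sum>J | J \<in> all_compositions \<and> sum_list J \<le> N. power_sum_coeff I (mset J) *\<^sub>R M_qsym J)"
    using 0 finite_compositions_le[of N]
    by (intro power_sum_M_qsym_expansion) (auto simp: mem_compositions)
  then show ?case by simp
next
  case (Suc a)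
  define C where "C = {J. J \<in> all_compositions \<and> sum_list J \<le> N}"
  have fin: "finite C" using finite_compositions_le[of N] by (simp add: C_def)
  let ?t = "\<lambda>X Y. power_sum_coeff I (mset X + mset Y) *\<^sub>R (M_qsym X * psi a Y)"
  have "(\<Sum>J\<in>C. power_sum_coeff I (mset J) *\<^sub>R psi (Suc a) J)
      = (\<Sum>(J, j)\<in>Sigma C (\<lambda>J. {..length J}). ?t (take j J) (drop j J))"
    by (simp add: sum.Sigma[symmetric] fin scaleR_sum_right flip: mset_append)
  \<comment> \<open>A composition with a cut point is a pair whose concatenation lies in
    \<open>C\<close>.\<close>
  also have "\<dots> = (\<Sum>(X, Y)\<in>{(X, Y). X @ Y \<in> C}. ?t X Y)"
    by (rule sum.reindex_bij_witness
        [where i = "\<lambda>(X, Y). (X @ Y, length X)" and j = "\<lambda>(J, j). (take j J, drop j J)"]) auto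
  \<comment> \<open>A pair whose concatenation leaves \<open>C\<close> has degree above N, where p_I
    has coefficient 0. Over the full rectangle the sum factors.\<close>
  also have "\<dots> = (\<Sum>(X, Y)\<in>C \<times> C. ?t X Y)"
  proof (rule sum.mono_neutral_left)
    show "{(X, Y). X @ Y \<in> C} \<subseteq> C \<times> C" by (auto simp: C_def)
    have "power_sum_coeff I (mset X + mset Y) = 0" if "X \<in> C" "Y \<in> C" "X @ Y \<notin> C" for X Y
      using power_sum_coeff_degree[of I "mset X + mset Y"] that Suc.prems by (auto simp: C_def sum_mset_sum_list)
    then show "\<forall>p\<in>C \<times> C - {(X, Y). X @ Y \<in> C}. (case p of (X, Y) \<Rightarrow> ?t X Y) = 0"
      by (force simp: scaleR_eq_0_iff)
  qed (use fin in simp)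
  also have "\<dots> = (\<Sum>(A, B)\<leftarrow>splits I. (\<Sum>X\<in>C. power_sum_coeff A (mset X) *\<^sub>R M_qsym X) *
      (\<Sum>Y\<in>C. power_sum_coeff B (mset Y) *\<^sub>R psi a Y))"
    by (simp add: sum.cartesian_product[symmetric] power_sum_coeff_add
        sum_product_sum_list[where f = "\<lambda>A X. power_sum_coeff A (mset X)" and g = "\<lambda>B Y. power_sum_coeff B (mset Y)"])
  also have "\<dots> = (\<Sum>(A, B)\<leftarrow>splits I. real (Suc a) ^ length B *\<^sub>R power_sum I)"
  proof (rule arg_cong[where f = sum_list], rule map_cong[OF refl], clarify)
    fix A B assume AB: "(A, B) \<in> set (splits I)"
    note D = set_splitsD[OF AB Suc.prems(1)]
    have "(\<Sum>X\<in>C. power_sum_coeff A (mset X) *\<^sub>R M_qsym X) = power_sum A"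
      using D Suc.prems(2) fin by (intro power_sum_M_qsym_expansion[symmetric]) (auto simp: C_def mem_compositions)
    moreover have "(\<Sum>Y\<in>C. power_sum_coeff B (mset Y) *\<^sub>R psi a Y) = real (Suc a) ^ length B *\<^sub>R power_sum B"
      unfolding C_def using D Suc.prems(2) by (intro Suc.IH) auto
    ultimately show "(\<Sum>X\<in>C. power_sum_coeff A (mset X) *\<^sub>R M_qsym X) * (\<Sum>Y\<in>C. power_sum_coeff B (mset Y) *\<^sub>R psi a Y)
        = real (Suc a) ^ length B *\<^sub>R power_sum I"
      using power_sum_splits[OF AB] by simp
  qed
  also have "\<dots> = (\<Sum>(A, B)\<leftarrow>splits I. real (Suc a) ^ length B) *\<^sub>R power_sum I"
  proof -
    have "(\<Sum>(A, B)\<leftarrow>xs. r B *\<^sub>R power_sum I) = (\<Sum>(A, B)\<leftarrow>xs. r B) *\<^sub>R power_sum I"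
      for xs :: "(nat list \<times> nat list) list" and r
      by (induction xs) (auto simp: scaleR_add_left)
    then show ?thesis .
  qed
  also have "\<dots> = real (Suc (Suc a)) ^ length I *\<^sub>R power_sum I"
    by (simp add: sum_splits_power)
  finally show ?case by (simp only: C_def)
qed

section \<open>The eigenfunction\<close>

text \<open>The individual pairings stay implicit; their sums over coarsenings are what the passage
  from F to M asks for.\<close>

lemma sum_coarsenings_hall_inner:
  assumes "I \<in> compositions n" and "J \<in> compositions n"
  shows "(\<Sum>K | K \<in> compositions n \<and> refines J K. hall_inner (power_sum I) (ribbon_schur K)) = power_sum_coeff I (mset J)"
proof -
  have J: "J \<in> all_compositions" "sum_list J = n" using assms(2) by (auto simp: mem_compositions)
  have "(\<Sum>K | K \<in> compositions n \<and> refines J K. hall_inner (power_sum I) (ribbon_schur K))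
      = hall_inner (power_sum I) (complete_hom J)"
    unfolding complete_hom_eq_sum_ribbon_schur[OF J(1)] J(2)
    by (rule hall_inner_power_sum_sum[OF assms(1), symmetric]) (auto intro: ribbon_schur_in_hom_space)
  then show ?thesis by (simp add: hall_inner_power_sum_complete_hom[OF assms])
qed

text \<open>\<open>f\<close> is arbitrary because the exchange is made twice with the same weights:
  with \<open>M_qsym\<close> for p_I itself, and with \<open>psi\<close> for its image under
  Psi.\<close>

lemma sum_coarsenings_swap:
  fixes g :: "nat list \<Rightarrow> real" and f :: "nat list \<Rightarrow> 'v::real_vector"
  shows "(\<Sum>K\<in>compositions n. g K *\<^sub>R (\<Sum>J | J \<in> compositions n \<and> refines J K. f J))
    = (\<Sum>J\<in>compositions n. (\<Sum>K | K \<in> compositions n \<and> refines J K. g K) *\<^sub>R f J)"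
  unfolding scaleR_sum_right scaleR_left.sum
  by (rule sum.swap_restrict) simp_all

theorem theorem6p2p10:
  fixes a n :: nat and I :: "nat list" and \<sigma> :: "nat \<Rightarrow> nat"
  assumes "1 \<le> a"
    and "I \<in> partitions n"
    and "\<sigma> permutes {1..n}"
    and "cycle_type n \<sigma> = I"
  shows "left_eigenfunction (compositions n) (hopf_power_matrix a n)
           (\<lambda>J. ribbon_character J \<sigma>) (real a powi (int (length I) - int n))"
proof -
  \<comment> \<open>\<open>psi\<close> counts coproducts, one fewer than tensor factors.\<close>
  obtain a' where a: "a = Suc a'" using assms(1) by (cases a) auto
  have I: "I \<in> compositions n" "I \<in> all_compositions" "sum_list I = n"
    using assms(2) partitions_subset(1)[of n] by (auto simp: mem_compositions subset_iff)
  define g where "g J = ribbon_character J \<sigma>" for J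
  have g: "g J = hall_inner (power_sum I) (ribbon_schur J)" if "J \<in> compositions n" for J
    using that assms(4) by (simp add: g_def ribbon_character_def mem_compositions skew_schur_ribbon_shape)
  have coarse: "(\<Sum>K | K \<in> compositions n \<and> refines J K. g K) = power_sum_coeff I (mset J)"
    if "J \<in> compositions n" for J
    using sum_coarsenings_hall_inner[OF I(1) that] g by simp
  have F: "F_qsym K = (\<Sum>J | J \<in> compositions n \<and> refines J K. 1 *\<^sub>R M_qsym J)"
    if "K \<in> compositions n" for K
    using that by (simp add: F_qsym_def mem_compositions)
  have hopf_F: "hopf_power a (F_qsym K) = (\<Sum>J | J \<in> compositions n \<and> refines J K. psi a' J)"
    if "K \<in> compositions n" for K
    unfolding a F[OF that] using compositions_subset[of n]
    by (subst hopf_power_eq_psi) auto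
  have p: "(\<Sum>K\<in>compositions n. g K *\<^sub>R F_qsym K) = power_sum I"
  proof -
    have "(\<Sum>K\<in>compositions n. g K *\<^sub>R F_qsym K)
        = (\<Sum>K\<in>compositions n. g K *\<^sub>R (\<Sum>J | J \<in> compositions n \<and> refines J K. M_qsym J))"
      by (intro sum.cong refl) (simp add: F)
    also have "\<dots> = (\<Sum>J\<in>compositions n. power_sum_coeff I (mset J) *\<^sub>R M_qsym J)"
      unfolding sum_coarsenings_swap using coarse by simp
    also have "\<dots> = power_sum I"
      using I compositions_subset by (intro power_sum_M_qsym_expansion[symmetric]) auto
    finally show ?thesis .
  qed
  have hopf_p: "(\<Sum>K\<in>compositions n. g K *\<^sub>R hopf_power a (F_qsym K)) = real a ^ length I *\<^sub>R power_sum I"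
  proof -
    have "(\<Sum>K\<in>compositions n. g K *\<^sub>R hopf_power a (F_qsym K))
        = (\<Sum>K\<in>compositions n. g K *\<^sub>R (\<Sum>J | J \<in> compositions n \<and> refines J K. psi a' J))"
      by (intro sum.cong refl) (simp add: hopf_F)
    also have "\<dots> = (\<Sum>J\<in>compositions n. power_sum_coeff I (mset J) *\<^sub>R psi a' J)"
      unfolding sum_coarsenings_swap using coarse by simp
    \<comment> \<open>\<open>psi_power_sum\<close> sums over all degrees up to n; the added
      compositions have the wrong degree for p_I.\<close>
    also have "\<dots> = (\<Sum>J | J \<in> all_compositions \<and> sum_list J \<le> n. power_sum_coeff I (mset J) *\<^sub>R psi a' J)"
    proof (rule sum.mono_neutral_left)
      show "finite {J. J \<in> all_compositions \<and> sum_list J \<le> n}"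
        using finite_compositions_le[of n] by simp
      show "\<forall>J\<in>{J. J \<in> all_compositions \<and> sum_list J \<le> n} - compositions n.
          power_sum_coeff I (mset J) *\<^sub>R psi a' J = 0"
      proof
        fix J assume "J \<in> {J. J \<in> all_compositions \<and> sum_list J \<le> n} - compositions n"
        then have "sum_list J \<noteq> sum_list I" using I(3) by (auto simp: mem_compositions)
        then have "power_sum_coeff I (mset J) = 0"
          using power_sum_coeff_degree[of I "mset J"] by (auto simp: sum_mset_sum_list)
        then show "power_sum_coeff I (mset J) *\<^sub>R psi a' J = 0" by simp
      qed
    qed (auto simp: mem_compositions)
    also have "\<dots> = real a ^ length I *\<^sub>R power_sum I"
      unfolding a using I by (intro psi_power_sum) auto
    finally show ?thesis .
  qed
  let ?rep = "representation (F_qsym ` compositions n)"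
  note indF = F_qsym_independent[of n]
  have hopf_span: "hopf_power a (F_qsym K) \<in> span (F_qsym ` compositions n)" if "K \<in> compositions n" for K
    unfolding hopf_F[OF that] span_F_qsym by (rule span_sum) (auto intro: psi_in_span)
  have "(\<Sum>K\<in>compositions n. g K * hopf_power_matrix a n K J)
      = real a powi (int (length I) - int n) * g J" if J: "J \<in> compositions n" for J
  proof -
    \<comment> \<open>Linearity of coordinates moves the weights inside: the left action of the
      matrix becomes a coordinate of the weighted sum of the Psi(F_K).\<close>
    have "(\<Sum>K\<in>compositions n. g K * hopf_power_matrix a n K J)
        = (\<Sum>K\<in>compositions n. ?rep ((g K / real a ^ n) *\<^sub>R hopf_power a (F_qsym K)) (F_qsym J))"
      by (intro sum.cong refl)
        (simp add: hopf_power_matrix_def representation_scale[OF indF(2)] hopf_span span_scale)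
    also have "\<dots> = ?rep (\<Sum>K\<in>compositions n. (g K / real a ^ n) *\<^sub>R hopf_power a (F_qsym K)) (F_qsym J)"
      by (subst representation_sum[OF indF(2)]) (auto intro: span_scale hopf_span)
    also have "(\<Sum>K\<in>compositions n. (g K / real a ^ n) *\<^sub>R hopf_power a (F_qsym K))
        = (1 / real a ^ n) *\<^sub>R (\<Sum>K\<in>compositions n. g K *\<^sub>R hopf_power a (F_qsym K))"
      by (simp add: scaleR_sum_right)
    also have "\<dots> = (\<Sum>K\<in>compositions n. (real a ^ length I / real a ^ n * g K) *\<^sub>R F_qsym K)"
      \<comment> \<open>p_I is turned back into its F expansion, so that the coordinate at F_J can
        be read off.\<close>
      unfolding hopf_p p[symmetric] by (simp add: scaleR_sum_right)
    also have "?rep \<dots> (F_qsym J) = real a ^ length I / real a ^ n * g J"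
      using representation_family[OF indF finite_compositions order_refl J,
          of "\<lambda>K. real a ^ length I / real a ^ n * g K"] J by simp
    also have "\<dots> = real a powi (int (length I) - int n) * g J"
      using assms(1) by (simp add: power_int_diff)
    finally show ?thesis .
  qed
  then show ?thesis by (simp add: left_eigenfunction_def g_def)
qed

end
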